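(* Consider the planar four-vortex problem with circulations $\Gamma_1=\Gamma_2=1$ and $\Gamma_3=\Gamma_4=m$, $m$ a real parameter. Let $\rho$ and $\sigma$ be defined by $$\rho=\frac{-m^2+m+3\pm\sqrt{(m^2-1)(m^2-4m-9)}}{m+2},$$ $$\sigma^2=\frac{2[(5m^2+10m+3)\rho+m^2+2m+3]}{(2m+1)(m+2)}.$$ If $y_3$ and $y_4$ are chosen to be distinct (real) roots of the quadratic $y^2-\sigma y+\rho$, with $\sigma = y_3+y_4\neq 0$, then $z=(1,0,-1,0,0,y_3,0,y_4)$ gives a kite relative equilibrium. The number and type of these solutions are given as follows: (i) At $m=1$, there are four concave solutions consisting of an equilateral triangle with a vortex at the center. These solutions are degenerate with nullity equal to three. (ii) For $0<m<1$, there are eight concave solutions corresponding to two geometrically distinct kite families. As $m$ passes through $0$, one of these families persists smoothly and becomes convex, continuing for $-1/2<m<0$. At $m=0$, this family has three collinear vortices and the exterior triangle becomes equilateral. (iii) Let $\widetilde m\approx-1.6804$ be the only real root of the cubic $5m^3+7m^2+3m+9$. For $-2<m<\widetilde m$, there are four convex solutions corresponding to one geometrically distinct family of kites. These kites emerge from a family of rhombus solutions via a pitchfork bifurcation at $m=\widetilde m$. (iv) For $m<-2$, there are four concave solutions corresponding to one geometrically distinct family of kites. (v) For all other values of $m$, there are no solutions.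
   Context: Planar four-vortex problem: vortices at $z_i=(x_i,y_i)\in\mathbb{R}^2$ with circulations $\Gamma_i$, $z=(z_1,\dots,z_4)\in\mathbb{R}^8$ (so $z=(1,0,-1,0,0,y_3,0,y_4)$ means $z_1=(1,0)$, $z_2=(-1,0)$, $z_3=(0,y_3)$, $z_4=(0,y_4)$), $r_{ij}=\|z_i-z_j\|$, $\Gamma=\sum_i\Gamma_i$ assumed nonzero, center of vorticity $c=\frac1\Gamma\sum_i\Gamma_iz_i$, Hamiltonian $H(z)=-\sum_{i<j}\Gamma_i\Gamma_j\ln r_{ij}$. A relative equilibrium is a collision-free $z$ satisfying, for some $\omega\ne0$, $\sum_{j\ne i}\frac{\Gamma_i\Gamma_j}{r_{ij}^2}(z_j-z_i)+\omega\Gamma_i(z_i-c)=0$ for all $i$. At the single value $m=0$ the family is understood by evaluating the formulas at $m=0$ (equivalently, by using the equations after division by $\Gamma_i$). Conventions: solutions are real configurations of the given form, counted as ordered pairs $(y_3,y_4)$ (labeled vortices; reflections are counted as distinct), and the rhombus case $y_3+y_4=0$ is excluded. Configurations are geometrically equivalent if they have the same shape up to reflection or relabeling of equal vortices; each geometrically distinct shape accounts for the four solutions $(y_3,y_4),(-y_3,-y_4),(y_4,y_3),(-y_4,-y_3)$. A configuration is concave if one vortex lies strictly inside the convex hull of the other three, and convex if no vortex is contained in the convex hull of the other three. A kite here is a configuration symmetric about the line through vortices 3 and 4. Degenerate: with $M=\mathrm{diag}\{\Gamma_1,\Gamma_1,\dots,\Gamma_4,\Gamma_4\}$, the matrix $D^2H(z)+\omega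 M$ always has a kernel of dimension at least one (from rotational symmetry); $z$ is degenerate if the kernel is larger, and the nullity is the dimension of the kernel. In (iii), the pitchfork bifurcation means that, as $m$ passes through $\widetilde m$, the branches of convex kites branch off from the family of relative equilibria for which the vortices form a rhombus with $z_1,z_2$ on one diagonal and $z_3,z_4$ on the other ($y_3=-y_4$): the rhombus (two critical points of $H$ modulo symmetry) gives rise to the four convex kites. *)

theory Defs
  imports "HOL-Analysis.Analysis"
begin

text \<open>
  A configuration of four vortices is an element of \<open>(real^2)^4\<close>, that is \<open>\<real>\<^sup>8\<close>. The labels are
  the elements 1, 2, 3, 4 of the type \<open>4\<close>; there \<open>4 = 0\<close>, so vortex 4 comes first in the order
  on labels. This is harmless in the Hamiltonian, whose terms are symmetric in \<open>i\<close> and \<open>j\<close>.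
\<close>

type_synonym config = "real^2^4"
type_synonym circ = "real^4"

definition total_circulation :: "circ \<Rightarrow> real" where
  "total_circulation \<Gamma> = (\<Sum>i\<in>UNIV. \<Gamma> $ i)"

definition center_of_vorticity :: "circ \<Rightarrow> config \<Rightarrow> real^2" where
  "center_of_vorticity \<Gamma> z = (1 / total_circulation \<Gamma>) *\<^sub>R (\<Sum>i\<in>UNIV. \<Gamma> $ i *\<^sub>R z $ i)"

definition hamiltonian :: "circ \<Rightarrow> config \<Rightarrow> real" where
  "hamiltonian \<Gamma> z = - (\<Sum>(i, j)\<in>{(i, j). i < j}. \<Gamma> $ i * \<Gamma> $ j * ln (dist (z $ i) (z $ j)))"

definition collision_free :: "config \<Rightarrow> bool" where
  "collision_free z \<longleftrightarrow> (\<forall>i j. i \<noteq> j \<longrightarrow> z $ i \<noteq> z $ j)"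

definition relative_equilibrium_with :: "circ \<Rightarrow> real \<Rightarrow> config \<Rightarrow> bool" where
  "relative_equilibrium_with \<Gamma> \<omega> z \<longleftrightarrow> \<omega> \<noteq> 0 \<and> collision_free z \<and>
     (\<forall>i. (\<Sum>j\<in>UNIV - {i}. (\<Gamma> $ i * \<Gamma> $ j / (dist (z $ i) (z $ j))\<^sup>2) *\<^sub>R (z $ j - z $ i))
          + (\<omega> * \<Gamma> $ i) *\<^sub>R (z $ i - center_of_vorticity \<Gamma> z) = 0)"

definition relative_equilibrium :: "circ \<Rightarrow> config \<Rightarrow> bool" where
  "relative_equilibrium \<Gamma> z \<longleftrightarrow> (\<exists>\<omega>. relative_equilibrium_with \<Gamma> \<omega> z)"

text \<open>
  The equations after division by \<open>\<Gamma> $ i\<close>. They are equivalent to the original ones if all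
  circulations are nonzero; otherwise they also constrain the vortices of circulation zero.
\<close>

definition relative_equilibrium_divided :: "circ \<Rightarrow> config \<Rightarrow> bool" where
  "relative_equilibrium_divided \<Gamma> z \<longleftrightarrow> (\<exists>\<omega>. \<omega> \<noteq> 0 \<and> collision_free z \<and>
     (\<forall>i. (\<Sum>j\<in>UNIV - {i}. (\<Gamma> $ j / (dist (z $ i) (z $ j))\<^sup>2) *\<^sub>R (z $ j - z $ i))
          + \<omega> *\<^sub>R (z $ i - center_of_vorticity \<Gamma> z) = 0))"

definition gradient :: "('a::euclidean_space \<Rightarrow> real) \<Rightarrow> 'a \<Rightarrow> 'a" where
  "gradient f w = (\<Sum>b\<in>Basis. frechet_derivative f (at w) b *\<^sub>R b)"

text \<open>The Hessian matrix is treated as a linear operator, the derivative of the gradient.\<close>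

definition hessian :: "('a::euclidean_space \<Rightarrow> real) \<Rightarrow> 'a \<Rightarrow> 'a \<Rightarrow> 'a" where
  "hessian f z = frechet_derivative (gradient f) (at z)"

definition mass_operator :: "circ \<Rightarrow> config \<Rightarrow> config" where
  "mass_operator \<Gamma> v = (\<chi> i. \<Gamma> $ i *\<^sub>R v $ i)"

definition nullity :: "circ \<Rightarrow> real \<Rightarrow> config \<Rightarrow> nat" where
  "nullity \<Gamma> \<omega> z = dim {v. hessian (hamiltonian \<Gamma>) z v + \<omega> *\<^sub>R mass_operator \<Gamma> v = 0}"

definition degenerate :: "circ \<Rightarrow> real \<Rightarrow> config \<Rightarrow> bool" where
  "degenerate \<Gamma> \<omega> z \<longleftrightarrow> nullity \<Gamma> \<omega> z > 1"

definition concave_config :: "config \<Rightarrow> bool" where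
  "concave_config z \<longleftrightarrow> (\<exists>i. z $ i \<in> interior (convex hull {z $ j | j. j \<noteq> i}))"

definition convex_config :: "config \<Rightarrow> bool" where
  "convex_config z \<longleftrightarrow> (\<forall>i. z $ i \<notin> convex hull {z $ j | j. j \<noteq> i})"

definition reflect_across :: "real^2 \<Rightarrow> real^2 \<Rightarrow> real^2 \<Rightarrow> real^2" where
  "reflect_across a b p =
     2 *\<^sub>R (a + (((p - a) \<bullet> (b - a)) / ((b - a) \<bullet> (b - a))) *\<^sub>R (b - a)) - p"

definition kite_config :: "config \<Rightarrow> bool" where
  "kite_config z \<longleftrightarrow> z $ 3 \<noteq> z $ 4 \<and>
     reflect_across (z $ 3) (z $ 4) (z $ 1) = z $ 2 \<and>
     reflect_across (z $ 3) (z $ 4) (z $ 2) = z $ 1"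

definition equilateral_triangle :: "real^2 \<Rightarrow> real^2 \<Rightarrow> real^2 \<Rightarrow> bool" where
  "equilateral_triangle p q r \<longleftrightarrow> p \<noteq> q \<and> dist p q = dist q r \<and> dist q r = dist r p"

definition equilateral_with_center :: "config \<Rightarrow> bool" where
  "equilateral_with_center z \<longleftrightarrow> (\<exists>i j k l. {i, j, k, l} = UNIV \<and>
     equilateral_triangle (z $ j) (z $ k) (z $ l) \<and>
     z $ i = (1 / 3) *\<^sub>R (z $ j + z $ k + z $ l))"

text \<open>Three collinear vortices whose outer two form an equilateral triangle with the fourth.\<close>

definition collinear_with_equilateral_exterior :: "config \<Rightarrow> bool" where
  "collinear_with_equilateral_exterior z \<longleftrightarrow> (\<exists>i j k l. {i, j, k, l} = UNIV \<and>
     z $ i \<in> open_segment (z $ j) (z $ k) \<and>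
     equilateral_triangle (z $ j) (z $ k) (z $ l))"

text \<open>Similarities of the plane, orientation reversing ones included.\<close>

definition similarity :: "(real^2 \<Rightarrow> real^2) \<Rightarrow> bool" where
  "similarity f \<longleftrightarrow> (\<exists>k>0. \<forall>p q. dist (f p) (f q) = k * dist p q)"

definition same_shape :: "circ \<Rightarrow> config \<Rightarrow> config \<Rightarrow> bool" where
  "same_shape \<Gamma> z w \<longleftrightarrow> (\<exists>\<pi> f. bij \<pi> \<and> (\<forall>i. \<Gamma> $ \<pi> i = \<Gamma> $ i) \<and> similarity f \<and>
     (\<forall>i. w $ \<pi> i = f (z $ i)))"

definition circulations :: "real \<Rightarrow> circ" where
  "circulations m = vector [1, 1, m, m]"

fun cfg :: "real \<times> real \<Rightarrow> config" where
  "cfg (y3, y4) = vector [vector [1, 0], vector [-1, 0], vector [0, y3], vector [0, y4]]"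

text \<open>
  The formulas for \<open>\<rho>\<close> and \<open>\<sigma>\<^sup>2\<close> make sense only for real \<open>\<rho>\<close> and nonzero denominators.
  The sign of \<open>\<sigma>\<close> is free.
\<close>

definition is_rho :: "real \<Rightarrow> real \<Rightarrow> bool" where
  "is_rho m \<rho> \<longleftrightarrow> m + 2 \<noteq> 0 \<and> (m\<^sup>2 - 1) * (m\<^sup>2 - 4 * m - 9) \<ge> 0 \<and>
     (\<exists>s\<in>{1, -1}. \<rho> = (- m\<^sup>2 + m + 3 + s * sqrt ((m\<^sup>2 - 1) * (m\<^sup>2 - 4 * m - 9))) / (m + 2))"

definition is_sigma :: "real \<Rightarrow> real \<Rightarrow> real \<Rightarrow> bool" where
  "is_sigma m \<rho> \<sigma> \<longleftrightarrow> (2 * m + 1) * (m + 2) \<noteq> 0 \<and>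
     \<sigma>\<^sup>2 = 2 * ((5 * m\<^sup>2 + 10 * m + 3) * \<rho> + m\<^sup>2 + 2 * m + 3) / ((2 * m + 1) * (m + 2))"

definition solutions :: "real \<Rightarrow> (real \<times> real) set" where
  "solutions m = {(y3, y4). \<exists>\<rho> \<sigma>. is_rho m \<rho> \<and> is_sigma m \<rho> \<sigma> \<and> \<sigma> \<noteq> 0 \<and> \<sigma> = y3 + y4 \<and> y3 \<noteq> y4 \<and>
     y3\<^sup>2 - \<sigma> * y3 + \<rho> = 0 \<and> y4\<^sup>2 - \<sigma> * y4 + \<rho> = 0}"

text \<open>
  All relative equilibria of the given form other than rhombi. At \<open>m = 0\<close> the undivided
  equations say nothing about vortices 3 and 4, so the divided ones are used.
\<close>

definition kite_equilibria :: "real \<Rightarrow> (real \<times> real) set" where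
  "kite_equilibria m = {(y3, y4). y3 + y4 \<noteq> 0 \<and>
     (if m = 0 then relative_equilibrium_divided (circulations m) (cfg (y3, y4))
      else relative_equilibrium (circulations m) (cfg (y3, y4)))}"

definition num_shapes :: "real \<Rightarrow> nat" where
  "num_shapes m = card (solutions m //
     {(p, q). p \<in> solutions m \<and> q \<in> solutions m \<and> same_shape (circulations m) (cfg p) (cfg q)})"

fun four_solutions :: "real \<times> real \<Rightarrow> (real \<times> real) set" where
  "four_solutions (y3, y4) = {(y3, y4), (- y3, - y4), (y4, y3), (- y4, - y3)}"

text \<open>Infinite differentiability; intended for open sets only.\<close>

definition smooth_on :: "real set \<Rightarrow> (real \<Rightarrow> real) \<Rightarrow> bool" where
  "smooth_on I f \<longleftrightarrow> (\<forall>k. \<forall>x\<in>I. ((deriv ^^ k) f) differentiable (at x))"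

definition kite_family :: "real set \<Rightarrow> (real \<Rightarrow> real) \<Rightarrow> (real \<Rightarrow> real) \<Rightarrow> bool" where
  "kite_family I a b \<longleftrightarrow> smooth_on I a \<and> smooth_on I b \<and> (\<forall>m\<in>I. (a m, b m) \<in> solutions m)"

text \<open>
  For \<open>y3 = - y4 = r\<close> with \<open>r > 0\<close> the vortices form a rhombus with vortices 1 and 2 on one
  diagonal and vortices 3 and 4 on the other.
\<close>

definition rhombus_family :: "real set \<Rightarrow> (real \<Rightarrow> real) \<Rightarrow> bool" where
  "rhombus_family I r \<longleftrightarrow> smooth_on I r \<and>
     (\<forall>m\<in>I. r m > 0 \<and> relative_equilibrium (circulations m) (cfg (r m, - r m)))"

text \<open>
  Pitchfork opening to the left: near \<open>c \<mu>0\<close> the central branch \<open>c\<close> is the only member of \<open>E\<close>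
  for \<open>\<mu> \<ge> \<mu>0\<close>, and for \<open>\<mu> < \<mu>0\<close> exactly two further branches \<open>p\<close>, \<open>q\<close> emanate from it.
\<close>

definition pitchfork_at ::
    "(real \<Rightarrow> (real \<times> real) set) \<Rightarrow> real \<Rightarrow> (real \<Rightarrow> real \<times> real) \<Rightarrow>
     (real \<Rightarrow> real \<times> real) \<Rightarrow> (real \<Rightarrow> real \<times> real) \<Rightarrow> bool" where
  "pitchfork_at E \<mu>0 c p q \<longleftrightarrow> (\<exists>\<delta>>0. \<exists>U. open U \<and> c \<mu>0 \<in> U \<and>
     continuous_on {\<mu>0 - \<delta><..<\<mu>0 + \<delta>} c \<and>
     continuous_on {\<mu>0 - \<delta><..<\<mu>0} p \<and> continuous_on {\<mu>0 - \<delta><..<\<mu>0} q \<and>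
     (p \<longlongrightarrow> c \<mu>0) (at_left \<mu>0) \<and> (q \<longlongrightarrow> c \<mu>0) (at_left \<mu>0) \<and>
     (\<forall>\<mu>\<in>{\<mu>0 - \<delta><..<\<mu>0}. E \<mu> \<inter> U = {c \<mu>, p \<mu>, q \<mu>} \<and> distinct [c \<mu>, p \<mu>, q \<mu>]) \<and>
     (\<forall>\<mu>\<in>{\<mu>0..<\<mu>0 + \<delta>}. E \<mu> \<inter> U = {c \<mu>}))"

definition equilibria :: "real \<Rightarrow> (real \<times> real) set" where
  "equilibria m = {p. relative_equilibrium (circulations m) (cfg p)}"

definition m_tilde :: real where
  "m_tilde = (THE x. 5 * x ^ 3 + 7 * x\<^sup>2 + 3 * x + 9 = 0)"

end

theory Submission
  imports Defs
begin

text \<open>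
  Write \<open>\<sigma> = y3 + y4\<close>, \<open>\<rho> = y3 * y4\<close>. Sum and difference of the equations for vortices 3 and 4, divided
  by \<open>\<sigma>\<close> and \<open>y3 - y4\<close>, are polynomial in \<open>\<rho>\<close> and \<open>\<sigma>\<^sup>2\<close>. Eliminating \<open>\<sigma>\<^sup>2\<close> leaves a cubic in \<open>\<rho>\<close>
  with the factor \<open>1 + \<rho>\<close>, which belongs to \<open>\<omega> = 0\<close>; the other factor is the quadratic with the two
  stated roots. A root yields a configuration iff \<open>\<sigma>\<^sup>2 > 0\<close> and \<open>\<sigma>\<^sup>2 - 4 * \<rho> > 0\<close>, and then exactly the
  four sign and order variants of one pair \<open>(y3, y4)\<close>. Since \<open>(m + 2) * \<rho> * (\<sigma>\<^sup>2 - 4 * \<rho>) = m * (1 + \<rho>)\<^sup>2\<close>,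
  the second condition only depends on the sign of \<open>m * (m + 2) * \<rho>\<close>, and the first one is decided by the
  sign of \<open>5 * m ^ 3 + 7 * m\<^sup>2 + 3 * m + 9\<close> where it is not implied by the second. The sign of \<open>\<rho>\<close> tells
  convex from concave kites, and \<open>\<rho>\<close> is a similarity invariant because the distance of the two vortices
  of circulation 1 is fixed. Everything is given by square roots of positive functions of \<open>m\<close>, hence
  smooth. At \<open>m_tilde\<close> the kite has \<open>\<sigma> = 0\<close>, so that it is a rhombus.
\<close>

section \<open>Equations for configurations on two axes\<close>


text \<open>The cubic is the nontrivial factor of the resultant, with respect to
  \<open>\<rho>\<close>, of the quadratic \<open>rho_poly\<close> and the linear numerator of
  \<open>sigma_sq\<close>: a common zero is a kite that has degenerated to
  \<open>\<sigma> = 0\<close>. This is what allows the choice between the two roots for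
  \<open>-2 < m < m_tilde\<close> to be made without estimating radicals: the sign of
  \<open>rho_poly\<close> at the zero of \<open>sigma_sq\<close> tells whether that zero separates
  the roots. Elsewhere, too, roots are located by signs of values and coefficients of
  \<open>rho_poly\<close>; the radicals serve for order, continuity and smoothness. The branch
  \<open>rho_minus\<close> carries every family except the second one on \<open>0 < m < 1\<close>.
  Special care goes to the values of \<open>m\<close> at which something divides by zero: -2 and
  -1/2 in the formulas, -1 in the center of vorticity. The nullity at \<open>m = 1\<close> is
  independent of all this: the Hessian is computed, and its shifted kernel is exhibited as the image
  of an injective linear map from \<open>real^3\<close>.\<close>

lemma total_circulation_circulations: "total_circulation (circulations m) = 2 + 2 * m"
  by (simp add: total_circulation_def sum_4 circulations_def vector_def)

lemma circulations_nth [simp]: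
  "circulations m $ 1 = 1" "circulations m $ 2 = 1" "circulations m $ 3 = m" "circulations m $ 4 = m"
  by (simp_all add: circulations_def vector_def)

lemma cfg_nth [simp]:
  "cfg (a, b) $ 1 = vector [1, 0]" "cfg (a, b) $ 2 = vector [-1, 0]"
  "cfg (a, b) $ 3 = vector [0, a]" "cfg (a, b) $ 4 = vector [0, b]"
  by (simp_all add: cfg.simps vector_def)

declare cfg.simps [simp del]

lemma dist_square_2: "(dist p q)\<^sup>2 = (p $ 1 - q $ 1)\<^sup>2 + (p $ 2 - q $ 2)\<^sup>2" for p q :: "real^2"
  by (simp add: dist_vec_def L2_set_def sum_2 dist_real_def)

lemma collision_free_cfg: "collision_free (cfg (a, b)) \<longleftrightarrow> a \<noteq> b"
  by (auto simp: collision_free_def forall_4 vec_eq_iff forall_2)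

text \<open>Separated from \<open>\<omega> \<noteq> 0\<close> and from the absence of collisions, so
  that the same equations also serve for a prescribed \<open>\<omega>\<close>.\<close>

definition divided_equations :: "circ \<Rightarrow> real \<Rightarrow> config \<Rightarrow> bool" where
  "divided_equations \<Gamma> \<omega> z \<longleftrightarrow> (\<forall>i. (\<Sum>j\<in>UNIV - {i}. (\<Gamma> $ j / (dist (z $ i) (z $ j))\<^sup>2) *\<^sub>R (z $ j - z $ i))
          + \<omega> *\<^sub>R (z $ i - center_of_vorticity \<Gamma> z) = 0)"

lemma relative_equilibrium_divided_iff:
  "relative_equilibrium_divided \<Gamma> z \<longleftrightarrow> collision_free z \<and> (\<exists>\<omega>. \<omega> \<noteq> 0 \<and> divided_equations \<Gamma> \<omega> z)"
  unfolding relative_equilibrium_divided_def divided_equations_def by blast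

lemma equation_factor:
  "(\<Sum>j\<in>UNIV - {i}. (\<Gamma> $ i * \<Gamma> $ j / (dist (z $ i) (z $ j))\<^sup>2) *\<^sub>R (z $ j - z $ i))
      + (\<omega> * \<Gamma> $ i) *\<^sub>R (z $ i - center_of_vorticity \<Gamma> z)
    = \<Gamma> $ i *\<^sub>R ((\<Sum>j\<in>UNIV - {i}. (\<Gamma> $ j / (dist (z $ i) (z $ j))\<^sup>2) *\<^sub>R (z $ j - z $ i))
      + \<omega> *\<^sub>R (z $ i - center_of_vorticity \<Gamma> z))"
  by (simp add: scaleR_right_distrib scaleR_sum_right mult.commute)

lemma divided_imp_relative_equilibrium:
  "relative_equilibrium_divided \<Gamma> z \<Longrightarrow> relative_equilibrium \<Gamma> z"
  unfolding relative_equilibrium_divided_iff divided_equations_def relative_equilibrium_def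
    relative_equilibrium_with_def equation_factor
  by auto

lemma relative_equilibrium_with_iff:
  assumes "\<And>i. \<Gamma> $ i \<noteq> 0"
  shows "relative_equilibrium_with \<Gamma> \<omega> z \<longleftrightarrow> \<omega> \<noteq> 0 \<and> collision_free z \<and> divided_equations \<Gamma> \<omega> z"
  unfolding relative_equilibrium_with_def divided_equations_def equation_factor
  using assms by simp

lemma relative_equilibrium_iff_divided:
  assumes "\<And>i. \<Gamma> $ i \<noteq> 0"
  shows "relative_equilibrium \<Gamma> z \<longleftrightarrow> relative_equilibrium_divided \<Gamma> z"
  unfolding relative_equilibrium_def relative_equilibrium_divided_iff relative_equilibrium_with_iff[OF assms]
  by blast

lemma circulations_nonzero: "m \<noteq> 0 \<Longrightarrow> circulations m $ i \<noteq> 0"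
  using exhaust_4[of i] by auto

text \<open>Avoids computing \<open>UNIV - {i}\<close> for each label; in the equations the
  subtracted term vanishes, since it contains \<open>z $ i - z $ i\<close>.\<close>

lemma sum_remove_4:
  fixes f :: "4 \<Rightarrow> 'b::ab_group_add"
  shows "sum f (UNIV - {i}) = f 1 + f 2 + f 3 + f 4 - f i"
  by (simp add: sum_diff1 sum_4)

text \<open>Vortices 1 and 2 cancel. The formula survives \<open>m = -1\<close>, where both sides
  are 0 by division by zero.\<close>

lemma center_of_vorticity_cfg:
  "center_of_vorticity (circulations m) (cfg (a, b)) = vector [0, m * (a + b) / (2 + 2 * m)]"
  by (simp add: center_of_vorticity_def total_circulation_circulations sum_4 vec_eq_iff forall_2 algebra_simps add_divide_distrib)

text \<open>By the mirror symmetry the eight scalar equations collapse: the first components for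
  vortices 1 and 2 both give \<open>\<omega>\<close>, those for 3 and 4 are trivial, and the second
  components for 1 and 2 coincide.\<close>

lemma divided_equations_cfg:
  "divided_equations (circulations m) \<omega> (cfg (a, b)) \<longleftrightarrow>
     \<omega> = 1 / 2 + m / (1 + a\<^sup>2) + m / (1 + b\<^sup>2) \<and>
     m * a / (1 + a\<^sup>2) + m * b / (1 + b\<^sup>2) = \<omega> * (m * (a + b) / (2 + 2 * m)) \<and>
     m / (b - a) - 2 * a / (1 + a\<^sup>2) + \<omega> * (a - m * (a + b) / (2 + 2 * m)) = 0 \<and>
     m / (a - b) - 2 * b / (1 + b\<^sup>2) + \<omega> * (b - m * (a + b) / (2 + 2 * m)) = 0"
proof -
  \<comment> \<open>No condition on \<open>x\<close>: at 0 both sides are 0, so \<open>a = b\<close>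
    needs no separate treatment.\<close>
  have e: "m * x / x\<^sup>2 = m / x" for x
    by (simp add: power2_eq_square)
  have "m * (b - a) / (a - b)\<^sup>2 = m / (b - a)" "m * (a - b) / (b - a)\<^sup>2 = m / (a - b)"
    using e[of "b - a"] e[of "a - b"]
    by (simp_all only: power2_commute[of b a])
  then show ?thesis
    unfolding divided_equations_def forall_4 sum_remove_4 center_of_vorticity_cfg vec_eq_iff forall_2
    by (simp add: dist_square_2) argo
qed

definition rho_poly :: "real \<Rightarrow> real \<Rightarrow> real" where
  "rho_poly m \<rho> = (m + 2) * \<rho>\<^sup>2 + 2 * (m\<^sup>2 - m - 3) * \<rho> + m * (2 * m + 1)"

definition sigma_sq :: "real \<Rightarrow> real \<Rightarrow> real" where
  "sigma_sq m \<rho> = 2 * ((5 * m\<^sup>2 + 10 * m + 3) * \<rho> + m\<^sup>2 + 2 * m + 3) / ((2 * m + 1) * (m + 2))"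

definition disc :: "real \<Rightarrow> real" where
  "disc m = (m\<^sup>2 - 1) * (m\<^sup>2 - 4 * m - 9)"

text \<open>The sum of the equations for vortices 3 and 4 is linear in \<open>\<omega>\<close> and
  determines it, because \<open>a + b \<noteq> 0\<close>. What is left is that this value agrees
  with the one from vortices 1 and 2, and the difference of the two equations; both become
  polynomial in \<open>a + b\<close> and \<open>a * b\<close>. The condition
  \<open>1 + a * b \<noteq> 0\<close> is \<open>\<omega> \<noteq> 0\<close>.\<close>

lemma relative_equilibrium_divided_cfg:
  assumes m: "m \<noteq> -1" and \<sigma>: "a + b \<noteq> 0"
  shows "relative_equilibrium_divided (circulations m) (cfg (a, b)) \<longleftrightarrow> a \<noteq> b \<and> 1 + a * b \<noteq> 0 \<and>
    (1 + 2 * m) * (a + b)\<^sup>2 = 3 + (6 + 8 * m) * (a * b) - (a * b)\<^sup>2 \<and>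
    (2 + m) * (a * b) * (a + b)\<^sup>2 = m * (1 + a * b)\<^sup>2 + 4 * (2 + m) * (a * b)\<^sup>2"
proof (cases "a = b")
  case False
  define A B where "A = 1 + a\<^sup>2" and "B = 1 + b\<^sup>2"
  have pos: "A > 0" "B > 0"
    by (simp_all add: A_def B_def add_pos_nonneg)
  define c where "c = m * (a + b) / (2 + 2 * m)"
  \<comment> \<open>The value of \<open>\<omega>\<close> that solves the sum of the equations for
    vortices 3 and 4.\<close>
  define w where "w = 2 * (1 + m) * (1 + a * b) / (A * B)"
  have f: "a / A + b / B = (a + b) * (1 + a * b) / (A * B)" "a / A - b / B = (a - b) * (1 - a * b) / (A * B)"
    using pos by (simp_all add: field_simps A_def B_def power2_eq_square)
  have c: "c * (1 + m) = m * (a + b) / 2"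
    using m by (simp add: c_def divide_simps)
  have w: "(m / (b - a) - 2 * a / A + \<omega> * (a - c)) + (m / (a - b) - 2 * b / B + \<omega> * (b - c)) = 0 \<longleftrightarrow> \<omega> = w" for \<omega>
  proof -
    have "m / (a - b) = - (m / (b - a))"
      by (metis minus_diff_eq minus_divide_right)
    then have "(m / (b - a) - 2 * a / A + \<omega> * (a - c)) + (m / (a - b) - 2 * b / B + \<omega> * (b - c))
        = \<omega> * (a + b - 2 * c) - 2 * (a / A + b / B)"
      by (simp add: algebra_simps)
    also have "a + b - 2 * c = (a + b) / (1 + m)"
      using m c by (simp add: field_simps)
    also have "\<omega> * ((a + b) / (1 + m)) - 2 * (a / A + b / B) = (a + b) / (1 + m) * (\<omega> - w)"
      unfolding f using m pos by (simp add: w_def field_simps)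
    finally show ?thesis
      using m \<sigma> by simp
  qed
  have diff: "(m / (b - a) - 2 * a / A + w * (a - c)) - (m / (a - b) - 2 * b / B + w * (b - c)) = 0 \<longleftrightarrow>
      m * (A * B) = (a - b)\<^sup>2 * ((1 + m) * (1 + a * b) - (1 - a * b))"
  proof -
    have "m / (a - b) = - (m / (b - a))"
      by (metis minus_diff_eq minus_divide_right)
    then have "(m / (b - a) - 2 * a / A + w * (a - c)) - (m / (a - b) - 2 * b / B + w * (b - c))
        = 2 * m / (b - a) - 2 * (a / A - b / B) + w * (a - b)"
      by (simp add: algebra_simps)
    also have "\<dots> = 2 / ((b - a) * (A * B)) * (m * (A * B) - (a - b)\<^sup>2 * ((1 + m) * (1 + a * b) - (1 - a * b)))"
      unfolding f w_def using False pos by (simp add: divide_simps) (simp add: power2_eq_square algebra_simps)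
    finally show ?thesis
      using False pos by simp
  qed
  \<comment> \<open>This equation comes for free, as it must: weighted by the circulations, all
    equations add up to zero because the interactions are pairwise opposite.\<close>
  have momentum: "m * a / A + m * b / B = w * c"
  proof -
    have "m * a / A + m * b / B = m * (a / A + b / B)"
      by (simp add: algebra_simps)
    also have "\<dots> = w * c"
      unfolding f w_def c_def using m pos by (simp add: divide_simps)
    finally show ?thesis .
  qed
  have "relative_equilibrium_divided (circulations m) (cfg (a, b)) \<longleftrightarrow>
      w \<noteq> 0 \<and> w = 1 / 2 + m / A + m / B \<and>
      m * (A * B) = (a - b)\<^sup>2 * ((1 + m) * (1 + a * b) - (1 - a * b))"
  proof -
    define X where "X \<omega> = m / (b - a) - 2 * a / A + \<omega> * (a - c)" for \<omega>
    define Y where "Y \<omega> = m / (a - b) - 2 * b / B + \<omega> * (b - c)" for \<omega>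
    have "X \<omega> = 0 \<and> Y \<omega> = 0 \<longleftrightarrow> X \<omega> + Y \<omega> = 0 \<and> X \<omega> - Y \<omega> = 0" for \<omega>
      by auto
    then have "X \<omega> = 0 \<and> Y \<omega> = 0 \<longleftrightarrow> \<omega> = w \<and> X w - Y w = 0" for \<omega>
      using w[of \<omega>] unfolding X_def Y_def by blast
    then show ?thesis
      unfolding relative_equilibrium_divided_iff divided_equations_cfg collision_free_cfg diff[symmetric]
        A_def[symmetric] B_def[symmetric] c_def[symmetric] X_def[symmetric] Y_def[symmetric]
      using False momentum by auto
  qed
  also have "w = 1 / 2 + m / A + m / B \<longleftrightarrow> 4 * (1 + m) * (1 + a * b) = A * B + 2 * m * (A + B)"
    unfolding w_def using pos by (simp add: divide_simps) (auto simp: algebra_simps)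
  also have "w \<noteq> 0 \<longleftrightarrow> 1 + a * b \<noteq> 0"
    using m pos by (simp add: w_def)
  also have "A * B = (1 - a * b)\<^sup>2 + (a + b)\<^sup>2"
    by (simp add: A_def B_def power2_eq_square algebra_simps)
  also have "A + B = 2 + (a + b)\<^sup>2 - 2 * (a * b)"
    by (simp add: A_def B_def power2_eq_square algebra_simps)
  finally show ?thesis
    using False by (auto simp: power2_eq_square algebra_simps)
qed (simp add: relative_equilibrium_divided_iff collision_free_cfg)

text \<open>Here the center of vorticity is the origin for every \<open>m\<close>, and the equations
  for vortices 3 and 4 are negatives of each other. Inserting \<open>\<omega>\<close> leaves a
  quadratic in the square of \<open>a\<close>; the last condition is
  \<open>\<omega> \<noteq> 0\<close>.\<close>

lemma relative_equilibrium_divided_rhombus: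
  "relative_equilibrium_divided (circulations m) (cfg (a, - a)) \<longleftrightarrow>
     a \<noteq> 0 \<and> (a\<^sup>2)\<^sup>2 + 3 * (m - 1) * a\<^sup>2 - m = 0 \<and> 1 + a\<^sup>2 + 4 * m \<noteq> 0"
proof (cases "a = 0")
  case False
  have pos: "1 + a\<^sup>2 > 0" by (simp add: add_pos_nonneg)
  define w where "w = 1 / 2 + m / (1 + a\<^sup>2) + m / (1 + a\<^sup>2)"
  have "m / (- a - a) - 2 * a / (1 + a\<^sup>2) + w * a = ((a\<^sup>2)\<^sup>2 + 3 * (m - 1) * a\<^sup>2 - m) / (2 * a * (1 + a\<^sup>2))"
    unfolding w_def using False pos by (simp add: divide_simps) (simp add: power2_eq_square power4_eq_xxxx algebra_simps)
  moreover have "m / (a - - a) - 2 * - a / (1 + a\<^sup>2) + w * - a = - (m / (- a - a) - 2 * a / (1 + a\<^sup>2) + w * a)"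
    by (simp add: algebra_simps)
  moreover have "w = (1 + a\<^sup>2 + 4 * m) / (2 * (1 + a\<^sup>2))"
  proof -
    have "1 / 2 + m / T + m / T = (T + 4 * m) / (2 * T)" if "T > 0" for T
      using that by (simp add: field_simps)
    from this[OF pos] show ?thesis
      by (simp add: w_def)
  qed
  then have "w = 0 \<longleftrightarrow> 1 + a\<^sup>2 + 4 * m = 0"
    using pos by simp
  ultimately show ?thesis
    unfolding relative_equilibrium_divided_iff divided_equations_cfg collision_free_cfg
    using False pos by (auto simp flip: w_def)
qed (simp add: relative_equilibrium_divided_iff collision_free_cfg)

section \<open>The solution set\<close>


lemma rho_poly_square: "(m + 2) * rho_poly m \<rho> = ((m + 2) * \<rho> - (- m\<^sup>2 + m + 3))\<^sup>2 - disc m"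
  by (simp add: rho_poly_def disc_def power2_eq_square algebra_simps)

lemma rho_poly_eq_0_iff:
  assumes "m \<noteq> -2"
  shows "rho_poly m \<rho> = 0 \<longleftrightarrow> ((m + 2) * \<rho> - (- m\<^sup>2 + m + 3))\<^sup>2 = disc m"
proof -
  have "rho_poly m \<rho> = 0 \<longleftrightarrow> (m + 2) * rho_poly m \<rho> = 0"
    using assms by auto
  then show ?thesis
    unfolding rho_poly_square by simp
qed

text \<open>The reality condition is built into the polynomial form: at a real root,
  \<open>disc m\<close> is a square.\<close>

lemma is_rho_iff: "is_rho m \<rho> \<longleftrightarrow> m \<noteq> -2 \<and> rho_poly m \<rho> = 0"
proof (cases "m = -2")
  case False
  then have m: "m + 2 \<noteq> 0" by auto
  let ?x = "(m + 2) * \<rho> - (- m\<^sup>2 + m + 3)"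
  have eq: "\<rho> = (- m\<^sup>2 + m + 3 + s * sqrt (disc m)) / (m + 2) \<longleftrightarrow> ?x = s * sqrt (disc m)" for s
    using m by (simp add: field_simps)
  have "?x\<^sup>2 = disc m \<longleftrightarrow> disc m \<ge> 0 \<and> (?x = sqrt (disc m) \<or> ?x = - sqrt (disc m))"
  proof (cases "disc m \<ge> 0")
    case True
    then show ?thesis
      using power2_eq_iff[of ?x "sqrt (disc m)"] by simp
  next
    case False
    then have "?x\<^sup>2 \<noteq> disc m"
      using zero_le_power2[of ?x] by linarith
    then show ?thesis
      using False by simp
  qed
  then show ?thesis
    using False m eq[of 1] eq[of "-1"]
    unfolding rho_poly_eq_0_iff[OF False] is_rho_def disc_def[symmetric] by simp
qed (simp add: is_rho_def)

lemma is_sigma_iff: "is_sigma m \<rho> \<sigma> \<longleftrightarrow> m \<noteq> -2 \<and> m \<noteq> -1/2 \<and> \<sigma>\<^sup>2 = sigma_sq m \<rho>"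
  unfolding is_sigma_def sigma_sq_def by auto

text \<open>Vieta: with \<open>\<sigma> = a + b\<close>, being a root of the quadratic just says
  \<open>\<rho> = a * b\<close>, so the pair determines both parameters.\<close>

lemma solutions_iff:
  "(a, b) \<in> solutions m \<longleftrightarrow> a \<noteq> b \<and> a + b \<noteq> 0 \<and> m \<noteq> -2 \<and> m \<noteq> -1/2 \<and>
     rho_poly m (a * b) = 0 \<and> (a + b)\<^sup>2 = sigma_sq m (a * b)"
proof -
  have "a\<^sup>2 - (a + b) * a + \<rho> = 0 \<longleftrightarrow> \<rho> = a * b" "b\<^sup>2 - (a + b) * b + \<rho> = 0 \<longleftrightarrow> \<rho> = a * b" for \<rho>
    by (auto simp: power2_eq_square algebra_simps)
  then show ?thesis
    unfolding solutions_def is_rho_iff is_sigma_iff by auto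
qed

text \<open>After clearing denominators the two equilibrium equations hold up to
  \<open>rho_poly m \<rho>\<close> and \<open>(1 + \<rho>) * rho_poly m \<rho>\<close>
  respectively.\<close>

lemma sigma_sq_relations:
  assumes "rho_poly m \<rho> = 0" "m \<noteq> -2" "m \<noteq> -1/2"
  shows "(1 + 2 * m) * sigma_sq m \<rho> = 3 + (6 + 8 * m) * \<rho> - \<rho>\<^sup>2"
    and "(2 + m) * \<rho> * sigma_sq m \<rho> = m * (1 + \<rho>)\<^sup>2 + 4 * (2 + m) * \<rho>\<^sup>2"
proof -
  have nz: "m + 2 \<noteq> 0" "1 + 2 * m \<noteq> 0" "2 * m + 1 \<noteq> 0"
    using assms(2,3) by auto
  have "(m + 2) * ((1 + 2 * m) * sigma_sq m \<rho>) = sigma_sq m \<rho> * ((2 * m + 1) * (m + 2))"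
    by (simp add: algebra_simps)
  also have "\<dots> = 2 * ((5 * m\<^sup>2 + 10 * m + 3) * \<rho> + m\<^sup>2 + 2 * m + 3)"
    using nz unfolding sigma_sq_def by simp
  also have "\<dots> = (m + 2) * (3 + (6 + 8 * m) * \<rho> - \<rho>\<^sup>2) + rho_poly m \<rho>"
    by (simp add: rho_poly_def power2_eq_square algebra_simps)
  finally show 1: "(1 + 2 * m) * sigma_sq m \<rho> = 3 + (6 + 8 * m) * \<rho> - \<rho>\<^sup>2"
    using nz assms(1) by simp
  have "(1 + 2 * m) * ((2 + m) * \<rho> * sigma_sq m \<rho>) = (2 + m) * \<rho> * ((1 + 2 * m) * sigma_sq m \<rho>)"
    by (simp add: algebra_simps)
  also have "\<dots> = (1 + 2 * m) * (m * (1 + \<rho>)\<^sup>2 + 4 * (2 + m) * \<rho>\<^sup>2) - (1 + \<rho>) * rho_poly m \<rho>"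
    unfolding 1 by (simp add: rho_poly_def power2_eq_square power3_eq_cube algebra_simps)
  finally show "(2 + m) * \<rho> * sigma_sq m \<rho> = m * (1 + \<rho>)\<^sup>2 + 4 * (2 + m) * \<rho>\<^sup>2"
    using nz assms(1) by simp
qed

text \<open>So the value \<open>\<rho> = -1\<close>, which means \<open>\<omega> = 0\<close>, is a
  root only for \<open>m = -2\<close>.\<close>

lemma rho_poly_minus_one: "rho_poly m (- 1) = 4 * (m + 2)"
  by (simp add: rho_poly_def power2_eq_square algebra_simps)

text \<open>At \<open>m = -1\<close> the quadratic has the double root 1, which gives
  \<open>\<sigma> = 0\<close>. This disposes of vanishing total circulation.\<close>

lemma solutions_minus_one: "solutions (- 1) = {}"
proof -
  have "(a, b) \<notin> solutions (-1)" for a b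
  proof
    assume "(a, b) \<in> solutions (-1)"
    then have *: "(a * b - 1)\<^sup>2 = 0" "(a + b)\<^sup>2 = sigma_sq (-1) (a * b)" "a + b \<noteq> 0"
      unfolding solutions_iff rho_poly_def by (auto simp: power2_eq_square algebra_simps)
    then have "a * b = 1" by simp
    with *(2,3) show False
      by (simp add: sigma_sq_def)
  qed
  then show ?thesis by auto
qed

lemma solutions_iff_divided:
  assumes m: "m \<noteq> -1" and \<sigma>: "a + b \<noteq> 0"
  shows "(a, b) \<in> solutions m \<longleftrightarrow> relative_equilibrium_divided (circulations m) (cfg (a, b))"
proof
  assume "(a, b) \<in> solutions m"
  then have s: "a \<noteq> b" "m \<noteq> -2" "m \<noteq> -1/2" "rho_poly m (a * b) = 0" "(a + b)\<^sup>2 = sigma_sq m (a * b)"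
    unfolding solutions_iff by auto
  have "1 + a * b \<noteq> 0"
    using rho_poly_minus_one[of m] s(2,4) by (auto simp: add_eq_0_iff)
  then show "relative_equilibrium_divided (circulations m) (cfg (a, b))"
    unfolding relative_equilibrium_divided_cfg[OF m \<sigma>] s(5)
    using s(1) sigma_sq_relations[OF s(4,2,3)] by blast
next
  assume "relative_equilibrium_divided (circulations m) (cfg (a, b))"
  then have e: "a \<noteq> b" "1 + a * b \<noteq> 0"
    "(1 + 2 * m) * (a + b)\<^sup>2 = 3 + (6 + 8 * m) * (a * b) - (a * b)\<^sup>2"
    "(2 + m) * (a * b) * (a + b)\<^sup>2 = m * (1 + a * b)\<^sup>2 + 4 * (2 + m) * (a * b)\<^sup>2"
    unfolding relative_equilibrium_divided_cfg[OF m \<sigma>] by auto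
  \<comment> \<open>Elimination of \<open>\<sigma>\<close> from the two equations; the right side
    vanishes by them.\<close>
  have "(1 + a * b) * rho_poly m (a * b) =
      (1 + 2 * m) * (m * (1 + a * b)\<^sup>2 + 4 * (2 + m) * (a * b)\<^sup>2) -
      (2 + m) * (a * b) * (3 + (6 + 8 * m) * (a * b) - (a * b)\<^sup>2)"
    by (simp add: rho_poly_def power2_eq_square algebra_simps)
  also have "\<dots> = 0"
    unfolding e(3,4)[symmetric] by (simp add: algebra_simps)
  finally have Q: "rho_poly m (a * b) = 0"
    using e(2) by simp
  \<comment> \<open>At \<open>m = -2\<close> the polynomial is \<open>6 * (1 + \<rho>)\<close>,
    whose only root is ruled out by \<open>\<omega> \<noteq> 0\<close>.\<close>
  have m2: "m \<noteq> -2"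
    using Q e(2) by (auto simp: rho_poly_def)
  \<comment> \<open>The formulas exclude this mass, the equations do not. They would force
    \<open>a * b = 3\<close> and \<open>(a + b)\<^sup>2 = 92/9 < 12\<close>, so that
    \<open>(a - b)\<^sup>2\<close> would be negative.\<close>
  have m1: "m \<noteq> -1/2"
  proof
    assume m: "m = -1/2"
    then have "(3 - a * b) * (1 + a * b) = 0"
      using e(3) by (simp add: power2_eq_square algebra_simps)
    then have ab: "a * b = 3" using e(2) by simp
    have "(a - b)\<^sup>2 = (a + b)\<^sup>2 - 4 * (a * b)"
      by (simp add: power2_eq_square algebra_simps)
    moreover have "9 * (a + b)\<^sup>2 = 92"
      using e(4) unfolding m ab by simp
    ultimately show False
      using ab zero_le_power2[of "a - b"] by linarith
  qed
  have "(1 + 2 * m) * (a + b)\<^sup>2 = (1 + 2 * m) * sigma_sq m (a * b)"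
    using e(3) sigma_sq_relations(1)[OF Q m2 m1] by simp
  moreover have "1 + 2 * m \<noteq> 0" using m1 by auto
  ultimately show "(a, b) \<in> solutions m"
    unfolding solutions_iff using Q m1 m2 e(1) \<sigma> by simp
qed

lemma solutions_imp_divided:
  assumes "p \<in> solutions m"
  shows "relative_equilibrium_divided (circulations m) (cfg p)"
proof -
  obtain a b where p: "p = (a, b)" by fastforce
  moreover have "m \<noteq> -1"
    using assms solutions_minus_one by auto
  ultimately show ?thesis
    using assms solutions_iff_divided[of m a b] by (auto simp: solutions_iff)
qed

lemma solutions_eq_kite_equilibria:
  assumes "m \<noteq> -1"
  shows "solutions m = kite_equilibria m"
proof -
  have "(a, b) \<in> solutions m \<longleftrightarrow> (a, b) \<in> kite_equilibria m" for a b
    unfolding kite_equilibria_def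
    using solutions_iff_divided[OF assms, of a b]
    by (auto simp: relative_equilibrium_iff_divided[OF circulations_nonzero] solutions_iff)
  then show ?thesis by auto
qed

text \<open>The two inequalities are \<open>(y3 + y4)\<^sup>2 > 0\<close> and
  \<open>(y3 - y4)\<^sup>2 > 0\<close>. For \<open>m = -2\<close> and \<open>m = -1/2\<close> the
  set is empty without further ado, since division by zero makes \<open>sigma_sq\<close>
  zero.\<close>

definition admissible :: "real \<Rightarrow> real set" where
  "admissible m = {\<rho>. rho_poly m \<rho> = 0 \<and> sigma_sq m \<rho> > 0 \<and> sigma_sq m \<rho> > 4 * \<rho>}"

text \<open>Of the four variants of a pair, the representative with \<open>y3 + y4 > 0\<close> and
  \<open>y3 > y4\<close>.\<close>

definition kite_of :: "real \<Rightarrow> real \<Rightarrow> real \<times> real" where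
  "kite_of m \<rho> = ((sqrt (sigma_sq m \<rho>) + sqrt (sigma_sq m \<rho> - 4 * \<rho>)) / 2,
                  (sqrt (sigma_sq m \<rho>) - sqrt (sigma_sq m \<rho> - 4 * \<rho>)) / 2)"

lemma kite_of_properties:
  assumes "\<rho> \<in> admissible m" and "kite_of m \<rho> = (a, b)"
  shows "a + b > 0" "a - b > 0" "(a + b)\<^sup>2 = sigma_sq m \<rho>" "a * b = \<rho>"
proof -
  let ?s = "sqrt (sigma_sq m \<rho>)" and ?d = "sqrt (sigma_sq m \<rho> - 4 * \<rho>)"
  have ab: "a = (?s + ?d) / 2" "b = (?s - ?d) / 2"
    using assms(2) by (auto simp: kite_of_def)
  have pos: "sigma_sq m \<rho> > 0" "sigma_sq m \<rho> - 4 * \<rho> > 0"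
    using assms(1) by (auto simp: admissible_def)
  have sum: "a + b = ?s" and diff: "a - b = ?d"
    unfolding ab by (simp_all add: field_simps)
  show "a + b > 0" "a - b > 0" "(a + b)\<^sup>2 = sigma_sq m \<rho>"
    unfolding sum diff using pos by auto
  have "4 * (a * b) = (a + b)\<^sup>2 - (a - b)\<^sup>2"
    by (simp add: power2_eq_square algebra_simps)
  also have "\<dots> = 4 * \<rho>"
    unfolding sum diff using pos by simp
  finally show "a * b = \<rho>" by simp
qed

lemma solutions_eq_UN: "solutions m = (\<Union>\<rho>\<in>admissible m. four_solutions (kite_of m \<rho>))"
proof -
  have "(a, b) \<in> solutions m \<longleftrightarrow> (\<exists>\<rho>\<in>admissible m. (a, b) \<in> four_solutions (kite_of m \<rho>))" for a b
  proof
    assume "(a, b) \<in> solutions m"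
    then have s: "a \<noteq> b" "a + b \<noteq> 0" "rho_poly m (a * b) = 0" "(a + b)\<^sup>2 = sigma_sq m (a * b)"
      unfolding solutions_iff by auto
    have d: "(a - b)\<^sup>2 = sigma_sq m (a * b) - 4 * (a * b)"
      unfolding s(4)[symmetric] by (simp add: power2_eq_square algebra_simps)
    have "(a + b)\<^sup>2 > 0" "(a - b)\<^sup>2 > 0"
      using s(1,2) by auto
    then have "a * b \<in> admissible m"
      using s(3,4) d by (simp add: admissible_def)
    \<comment> \<open>The signs of \<open>a + b\<close> and \<open>a - b\<close> tell which of the
      four variants \<open>(a, b)\<close> is.\<close>
    moreover have "kite_of m (a * b) = ((\<bar>a + b\<bar> + \<bar>a - b\<bar>) / 2, (\<bar>a + b\<bar> - \<bar>a - b\<bar>) / 2)"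
      unfolding kite_of_def d[symmetric] unfolding s(4)[symmetric] by simp
    then have "(a, b) \<in> four_solutions (kite_of m (a * b))"
      by (auto simp: abs_if)
    ultimately show "\<exists>\<rho>\<in>admissible m. (a, b) \<in> four_solutions (kite_of m \<rho>)" by blast
  next
    assume "\<exists>\<rho>\<in>admissible m. (a, b) \<in> four_solutions (kite_of m \<rho>)"
    then obtain \<rho> where \<rho>: "\<rho> \<in> admissible m" and ab: "(a, b) \<in> four_solutions (kite_of m \<rho>)" by blast
    obtain c d where cd: "kite_of m \<rho> = (c, d)" by fastforce
    note c = kite_of_properties[OF \<rho> cd]
    have *: "(a, b) \<in> {(c, d), (- c, - d), (d, c), (- d, - c)}"
      using ab by (simp add: cd)
    then have "a * b = \<rho>" "(a + b)\<^sup>2 = (c + d)\<^sup>2" "a \<noteq> b" "a + b \<noteq> 0"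
      using c by (auto simp: power2_eq_square algebra_simps)
    moreover have "m \<noteq> -2" "m \<noteq> -1/2"
      using \<rho> by (auto simp: admissible_def sigma_sq_def)
    ultimately show "(a, b) \<in> solutions m"
      unfolding solutions_iff using \<rho> c(3) by (auto simp: admissible_def)
  qed
  then show ?thesis by auto
qed

lemma four_solutions_self: "p \<in> four_solutions p"
  by (cases p) simp

lemma four_solutions_mult: "(c, d) \<in> four_solutions (a, b) \<Longrightarrow> c * d = a * b"
  by auto

lemma four_solutions_eq: "p \<in> four_solutions q \<Longrightarrow> four_solutions p = four_solutions q"
  by (cases p; cases q) auto

lemma mult_kite_solutions:
  assumes "\<rho> \<in> admissible m" "(a, b) \<in> four_solutions (kite_of m \<rho>)"
  shows "a * b = \<rho>"
  using assms kite_of_properties(4)[OF assms(1)] four_solutions_mult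
  by (metis prod.exhaust)

lemma card_four_solutions:
  assumes "\<rho> \<in> admissible m"
  shows "card (four_solutions (kite_of m \<rho>)) = 4"
proof -
  obtain a b where ab: "kite_of m \<rho> = (a, b)" by fastforce
  note c = kite_of_properties[OF assms ab]
  have "distinct [(a, b), (- a, - b), (b, a), (- b, - a)]"
    using c(1,2) by auto
  then show ?thesis
    unfolding ab four_solutions.simps using distinct_card[of "[(a, b), (- a, - b), (b, a), (- b, - a)]"] by simp
qed

lemma finite_admissible: "finite (admissible m)"
proof (cases "m = -2")
  case False
  have "admissible m \<subseteq> {(- m\<^sup>2 + m + 3 + sqrt (disc m)) / (m + 2), (- m\<^sup>2 + m + 3 - sqrt (disc m)) / (m + 2)}"
    using is_rho_iff[of m] False by (auto simp: admissible_def is_rho_def disc_def)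
  then show ?thesis by (rule finite_subset) simp
qed (simp add: admissible_def sigma_sq_def)

text \<open>Different values of \<open>\<rho>\<close> give disjoint quadruples, because all members
  of a quadruple have product \<open>\<rho>\<close>.\<close>

lemma card_solutions: "card (solutions m) = 4 * card (admissible m)"
proof -
  have "card (solutions m) = (\<Sum>\<rho>\<in>admissible m. card (four_solutions (kite_of m \<rho>)))"
    unfolding solutions_eq_UN
  proof (rule card_UN_disjoint[OF finite_admissible])
    show "\<forall>\<rho>\<in>admissible m. finite (four_solutions (kite_of m \<rho>))"
      by (metis card.infinite card_four_solutions zero_neq_numeral)
    show "\<forall>\<rho>\<in>admissible m. \<forall>\<rho>'\<in>admissible m. \<rho> \<noteq> \<rho>' \<longrightarrow>
        four_solutions (kite_of m \<rho>) \<inter> four_solutions (kite_of m \<rho>') = {}"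
      using mult_kite_solutions by (metis (no_types, lifting) disjoint_iff prod.exhaust)
  qed
  also have "\<dots> = 4 * card (admissible m)"
    by (simp add: card_four_solutions)
  finally show ?thesis .
qed

section \<open>Shapes and convexity\<close>


lemma dist_cfg:
  "dist (cfg (a, b) $ 1) (cfg (a, b) $ 2) = 2" "dist (cfg (a, b) $ 2) (cfg (a, b) $ 1) = 2"
  "(dist (cfg (a, b) $ 1) (cfg (a, b) $ 3))\<^sup>2 = 1 + a\<^sup>2" "(dist (cfg (a, b) $ 1) (cfg (a, b) $ 4))\<^sup>2 = 1 + b\<^sup>2"
  "(dist (cfg (a, b) $ 2) (cfg (a, b) $ 3))\<^sup>2 = 1 + a\<^sup>2" "(dist (cfg (a, b) $ 2) (cfg (a, b) $ 4))\<^sup>2 = 1 + b\<^sup>2"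
  "(dist (cfg (a, b) $ 3) (cfg (a, b) $ 4))\<^sup>2 = (a - b)\<^sup>2" "(dist (cfg (a, b) $ 4) (cfg (a, b) $ 3))\<^sup>2 = (a - b)\<^sup>2"
  by (simp_all add: dist_square_2 power2_commute) (simp_all add: dist_vec_def L2_set_def sum_2 dist_real_def)

text \<open>Reflection in the first axis changes both signs, and interchanging the equal vortices 3
  and 4 swaps the entries; the four variants arise from these two operations.\<close>

lemma same_shape_four_solutions:
  assumes "q \<in> four_solutions p"
  shows "same_shape (circulations m) (cfg p) (cfg q)"
proof -
  obtain a b c d where p: "p = (a, b)" and q: "q = (c, d)" by fastforce
  define f :: "real \<Rightarrow> real^2 \<Rightarrow> real^2" where "f e v = vector [v $ 1, e * v $ 2]" for e v
  have f: "similarity (f e)" if "e\<^sup>2 = 1" for e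
  proof -
    have "(dist (f e v) (f e w))\<^sup>2 = (dist v w)\<^sup>2" for v w
      unfolding dist_square_2 using that
      by (simp add: f_def flip: right_diff_distrib) (simp add: power_mult_distrib)
    then have "dist (f e v) (f e w) = 1 * dist v w" for v w
      by simp
    then show ?thesis
      unfolding similarity_def using zero_less_one by blast
  qed
  define \<tau> :: "4 \<Rightarrow> 4" where "\<tau> = (id(3 := 4, 4 := 3))"
  have \<tau>: "bij \<tau>"
    by (rule o_bij[of \<tau>]) (auto simp: \<tau>_def fun_eq_iff)
  have f_nth [simp]: "f e (vector [u, v]) = vector [u, e * v]" for e u v
    by (simp add: f_def)
  have same: "same_shape (circulations m) (cfg (a, b)) (cfg (e * a, e * b))" if "e\<^sup>2 = 1" for e
    unfolding same_shape_def
    by (rule exI[of _ id], rule exI[of _ "f e"]) (use f[OF that] in \<open>simp add: forall_4\<close>)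
  have swap: "same_shape (circulations m) (cfg (a, b)) (cfg (e * b, e * a))" if "e\<^sup>2 = 1" for e
    unfolding same_shape_def
    by (rule exI[of _ \<tau>], rule exI[of _ "f e"]) (use f[OF that] \<tau> in \<open>simp add: forall_4 \<tau>_def\<close>)
  have "q = (1 * a, 1 * b) \<or> q = (-1 * a, -1 * b) \<or> q = (1 * b, 1 * a) \<or> q = (-1 * b, -1 * a)"
    using assms by (auto simp: p)
  then show ?thesis
    unfolding p using same[of 1] same[of "-1"] swap[of 1] swap[of "-1"] by fastforce
qed

text \<open>Since \<open>m \<noteq> 1\<close>, the relabeling preserves \<open>{1, 2}\<close>, at distance 2 in both configurations, so
  the similarity is an isometry.\<close>

lemma same_shape_imp_mult_eq:
  assumes "same_shape (circulations m) (cfg (a, b)) (cfg (c, d))" and "m \<noteq> 1"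
  shows "a * b = c * d"
proof -
  let ?z = "cfg (a, b)" and ?w = "cfg (c, d)"
  obtain \<pi> f k where \<pi>: "bij \<pi>" "\<And>i. circulations m $ \<pi> i = circulations m $ i"
    and k: "k > 0" "\<And>p q. dist (f p) (f q) = k * dist p q" and w: "\<And>i. ?w $ \<pi> i = f (?z $ i)"
    using assms(1) unfolding same_shape_def similarity_def by blast
  have dist_w: "dist (?w $ \<pi> i) (?w $ \<pi> j) = k * dist (?z $ i) (?z $ j)" for i j
    by (simp add: w k)
  have inj: "\<pi> i = \<pi> j \<longleftrightarrow> i = j" for i j
    using \<pi>(1) by (simp add: bij_is_inj inj_eq)
  have "circulations m $ i = 1 \<longleftrightarrow> i = 1 \<or> i = 2" for i
    using exhaust_4[of i] assms(2) by auto
  with \<pi>(2) have 12: "\<pi> i = 1 \<or> \<pi> i = 2 \<longleftrightarrow> i = 1 \<or> i = 2" for i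
    by metis
  have "\<pi> 1 = 1 \<and> \<pi> 2 = 2 \<or> \<pi> 1 = 2 \<and> \<pi> 2 = 1" "\<pi> 3 \<notin> {1, 2}" "\<pi> 4 \<notin> {1, 2}"
    using inj[of 1 2] 12[of 1] 12[of 2] 12[of 3] 12[of 4] by auto
  moreover from this have "\<pi> 3 = 3 \<and> \<pi> 4 = 4 \<or> \<pi> 3 = 4 \<and> \<pi> 4 = 3"
    using inj[of 3 4] exhaust_4[of "\<pi> 3"] exhaust_4[of "\<pi> 4"] by auto
  ultimately have p: "\<pi> 1 = 1 \<and> \<pi> 2 = 2 \<or> \<pi> 1 = 2 \<and> \<pi> 2 = 1" "\<pi> 3 = 3 \<and> \<pi> 4 = 4 \<or> \<pi> 3 = 4 \<and> \<pi> 4 = 3"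
    by auto
  have "k = 1"
    using dist_w[of 1 2] p(1) by (auto simp: dist_cfg simp del: cfg_nth)
  then have D: "(dist (?w $ \<pi> i) (?w $ \<pi> j))\<^sup>2 = (dist (?z $ i) (?z $ j))\<^sup>2" for i j
    by (simp add: dist_w)
  \<comment> \<open>These two quantities are the same for each of the remaining relabelings, and
    together they determine the product.\<close>
  have "(c - d)\<^sup>2 = (a - b)\<^sup>2" "c\<^sup>2 + d\<^sup>2 = a\<^sup>2 + b\<^sup>2"
    using p D[of 3 4] D[of 1 3] D[of 1 4] by (auto simp: dist_cfg simp del: cfg_nth)
  then show ?thesis
    by (simp add: power2_eq_square algebra_simps)
qed

text \<open>The shape classes are exactly the quadruples belonging to the admissible
  \<open>\<rho>\<close>: members of one quadruple have the same shape, and the shape determines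
  \<open>\<rho>\<close>.\<close>

lemma num_shapes_eq:
  assumes "m \<noteq> 1"
  shows "num_shapes m = card (admissible m)"
proof -
  let ?R = "{(p, q). p \<in> solutions m \<and> q \<in> solutions m \<and> same_shape (circulations m) (cfg p) (cfg q)}"
  have cls: "?R `` {p} = four_solutions (kite_of m \<rho>)"
    if \<rho>: "\<rho> \<in> admissible m" and p: "p \<in> four_solutions (kite_of m \<rho>)" for p \<rho>
  proof (intro equalityI subsetI)
    fix q assume "q \<in> ?R `` {p}"
    then have q: "q \<in> solutions m" "same_shape (circulations m) (cfg p) (cfg q)" by auto
    then obtain \<rho>' where \<rho>': "\<rho>' \<in> admissible m" "q \<in> four_solutions (kite_of m \<rho>')"
      unfolding solutions_eq_UN by blast
    obtain a b c d where ab: "p = (a, b)" and cd: "q = (c, d)" by fastforce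
    have "\<rho> = \<rho>'"
      using same_shape_imp_mult_eq[of m a b c d] q(2) assms
        mult_kite_solutions[of \<rho> m a b] mult_kite_solutions[of \<rho>' m c d] \<rho> p \<rho>' ab cd by simp
    then show "q \<in> four_solutions (kite_of m \<rho>)"
      using \<rho>'(2) by simp
  next
    fix q assume "q \<in> four_solutions (kite_of m \<rho>)"
    then show "q \<in> ?R `` {p}"
      using \<rho> p same_shape_four_solutions[of q p m] four_solutions_eq[OF p] 
      unfolding solutions_eq_UN by auto
  qed
  have nonempty: "\<exists>p. p \<in> four_solutions (kite_of m \<rho>)" for \<rho>
    using four_solutions_self by blast
  have "solutions m // ?R = (\<lambda>\<rho>. four_solutions (kite_of m \<rho>)) ` admissible m"
  proof (intro equalityI subsetI)
    fix X assume "X \<in> solutions m // ?R"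
    then obtain p where "p \<in> solutions m" "X = ?R `` {p}"
      by (auto elim: quotientE)
    moreover from this(1) obtain \<rho> where "\<rho> \<in> admissible m" "p \<in> four_solutions (kite_of m \<rho>)"
      unfolding solutions_eq_UN by blast
    ultimately show "X \<in> (\<lambda>\<rho>. four_solutions (kite_of m \<rho>)) ` admissible m"
      using cls by blast
  next
    fix X assume "X \<in> (\<lambda>\<rho>. four_solutions (kite_of m \<rho>)) ` admissible m"
    then obtain \<rho> where \<rho>: "\<rho> \<in> admissible m" "X = four_solutions (kite_of m \<rho>)" by blast
    moreover obtain p where p: "p \<in> four_solutions (kite_of m \<rho>)"
      using nonempty by blast
    moreover have "p \<in> solutions m"
      using \<rho>(1) p unfolding solutions_eq_UN by blast
    ultimately show "X \<in> solutions m // ?R"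
      using quotientI[of p "solutions m" ?R] cls[OF \<rho>(1) p] by simp
  qed
  moreover have "inj_on (\<lambda>\<rho>. four_solutions (kite_of m \<rho>)) (admissible m)"
  proof (rule inj_onI)
    fix \<rho> \<rho>' assume *: "\<rho> \<in> admissible m" "\<rho>' \<in> admissible m" 
      "four_solutions (kite_of m \<rho>) = four_solutions (kite_of m \<rho>')"
    obtain a b where "(a, b) \<in> four_solutions (kite_of m \<rho>)"
      using nonempty by fastforce
    then show "\<rho> = \<rho>'"
      using * mult_kite_solutions by metis
  qed
  ultimately show ?thesis
    unfolding num_shapes_def by (simp add: card_image)
qed

lemma kite_config_cfg: "a \<noteq> b \<Longrightarrow> kite_config (cfg (a, b))"
  by (simp add: kite_config_def reflect_across_def vec_eq_iff forall_2 inner_vec_def sum_2)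

lemma in_interior_triangle:
  assumes "a * b > 0" "\<bar>b\<bar> < \<bar>a\<bar>"
  shows "(vector [0, b] :: real^2) \<in> interior (convex hull {vector [1, 0], vector [-1, 0], vector [0, a]})"
proof (rule interiorI)
  \<comment> \<open>The open triangle in barycentric terms: \<open>p $ 2 / a\<close> is the weight
    of the apex, and the second inequality says that both base weights are positive. The base side
    is cut off by the first.\<close>
  let ?T = "{p :: real^2. p $ 2 / a > 0} \<inter> {p. p $ 2 / a + \<bar>p $ 1\<bar> < 1}"
  have a: "a \<noteq> 0" using assms(1) by auto
  show "open ?T"
    by (intro open_Int open_Collect_less continuous_intros) (use a in auto)
  have "b / a > 0"
    using assms(1) by (simp add: zero_less_divide_iff zero_less_mult_iff) linarith
  moreover have "b / a < 1"
    using assms(2) a abs_ge_self[of "b / a"] by (auto simp: abs_divide divide_simps split: if_splits)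
  ultimately show "vector [0, b] \<in> ?T" by simp
  show "?T \<subseteq> convex hull {vector [1, 0], vector [-1, 0], vector [0, a]}"
  proof
    fix p assume "p \<in> ?T"
    then have p: "p $ 2 / a > 0" "p $ 2 / a + \<bar>p $ 1\<bar> < 1" by auto
    define t where "t = p $ 2 / a"
    have "p = ((1 - t + p $ 1) / 2) *\<^sub>R vector [1, 0] + ((1 - t - p $ 1) / 2) *\<^sub>R vector [-1, 0] + t *\<^sub>R vector [0, a]"
      using a by (simp add: vec_eq_iff forall_2 t_def field_simps)
    moreover have "(1 - t + p $ 1) / 2 \<ge> 0" "(1 - t - p $ 1) / 2 \<ge> 0" "t \<ge> 0"
      "(1 - t + p $ 1) / 2 + (1 - t - p $ 1) / 2 + t = 1"
      using p by (auto simp: t_def[symmetric] field_simps)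
    ultimately show "p \<in> convex hull {vector [1, 0], vector [-1, 0], vector [0, a]}"
      unfolding convex_hull_3 by blast
  qed
qed

lemma others_4:
  "{f j | j::4. j \<noteq> 1} = {f 2, f 3, f 4}" "{f j | j::4. j \<noteq> 2} = {f 1, f 3, f 4}"
  "{f j | j::4. j \<noteq> 3} = {f 1, f 2, f 4}" "{f j | j::4. j \<noteq> 4} = {f 1, f 2, f 3}"
proof -
  have "{f j | j::4. j \<noteq> i} = f ` {j \<in> {1, 2, 3, 4}. j \<noteq> i}" for i
    using UNIV_4 by auto
  moreover have "{j \<in> {1, 2, 3, 4::4}. j \<noteq> 1} = {2, 3, 4}" "{j \<in> {1, 2, 3, 4::4}. j \<noteq> 2} = {1, 3, 4}"
    "{j \<in> {1, 2, 3, 4::4}. j \<noteq> 3} = {1, 2, 4}" "{j \<in> {1, 2, 3, 4::4}. j \<noteq> 4} = {1, 2, 3}"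
    by auto
  ultimately show
    "{f j | j::4. j \<noteq> 1} = {f 2, f 3, f 4}" "{f j | j::4. j \<noteq> 2} = {f 1, f 3, f 4}"
    "{f j | j::4. j \<noteq> 3} = {f 1, f 2, f 4}" "{f j | j::4. j \<noteq> 4} = {f 1, f 2, f 3}"
    by simp_all
qed

lemma concave_cfg:
  assumes "a * b > 0" "a\<^sup>2 \<noteq> b\<^sup>2"
  shows "concave_config (cfg (a, b))"
proof (cases "\<bar>b\<bar> < \<bar>a\<bar>")
  case True
  have "cfg (a, b) $ 4 \<in> interior (convex hull {cfg (a, b) $ j | j. j \<noteq> 4})"
    unfolding others_4 using in_interior_triangle[OF assms(1) True] by simp
  then show ?thesis
    unfolding concave_config_def by blast
next
  case False
  then have "\<bar>a\<bar> < \<bar>b\<bar>"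
    using assms(2) by (metis linorder_neqE_linordered_idom power2_abs)
  moreover have "b * a > 0"
    using assms(1) by (simp add: mult.commute)
  ultimately have "cfg (a, b) $ 3 \<in> interior (convex hull {cfg (a, b) $ j | j. j \<noteq> 3})"
    unfolding others_4 using in_interior_triangle[of b a] by simp
  then show ?thesis
    unfolding concave_config_def by blast
qed

lemma notin_convex_hull_halfspace:
  fixes a :: "'a::real_inner"
  assumes "\<And>x. x \<in> S \<Longrightarrow> a \<bullet> x \<le> 0" "a \<bullet> p > 0"
  shows "p \<notin> convex hull S"
proof
  assume "p \<in> convex hull S"
  moreover have "convex hull S \<subseteq> {x. a \<bullet> x \<le> 0}"
    by (rule hull_minimal) (use assms(1) in \<open>auto intro: convex_halfspace_le\<close>)
  ultimately show False using assms(2) by auto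
qed

text \<open>The segments 12 and 34 cross at the origin, so each vortex is separated from the other
  three by the line through the origin along the other diagonal; the position of the vortex gives a
  normal vector.\<close>

lemma convex_cfg:
  assumes "a * b < 0"
  shows "convex_config (cfg (a, b))"
  unfolding convex_config_def forall_4 others_4
proof (intro conjI)
  have in2: "(vector [u, v] :: real^2) \<bullet> vector [x, y] = u * x + v * y" for u v x y
    by (simp add: inner_vec_def sum_2)
  have "a \<noteq> 0" "b \<noteq> 0" using assms by auto
  then have pos: "a * a > 0" "b * b > 0"
    by (simp_all add: zero_less_mult_iff) linarith+
  show "cfg (a, b) $ 1 \<notin> convex hull {cfg (a, b) $ 2, cfg (a, b) $ 3, cfg (a, b) $ 4}"
    by (rule notin_convex_hull_halfspace[of _ "vector [1, 0]"]) (auto simp: in2)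
  show "cfg (a, b) $ 2 \<notin> convex hull {cfg (a, b) $ 1, cfg (a, b) $ 3, cfg (a, b) $ 4}"
    by (rule notin_convex_hull_halfspace[of _ "vector [-1, 0]"]) (auto simp: in2)
  show "cfg (a, b) $ 3 \<notin> convex hull {cfg (a, b) $ 1, cfg (a, b) $ 2, cfg (a, b) $ 4}"
    by (rule notin_convex_hull_halfspace[of _ "vector [0, a]"]) (use assms pos in \<open>auto simp: in2\<close>)
  show "cfg (a, b) $ 4 \<notin> convex hull {cfg (a, b) $ 1, cfg (a, b) $ 2, cfg (a, b) $ 3}"
    by (rule notin_convex_hull_halfspace[of _ "vector [0, b]"])
      (use assms pos in \<open>auto simp: in2 mult.commute\<close>)
qed

section \<open>Admissible values of \<open>\<rho>\<close>\<close>


text \<open>The index is the sign of the radical. For \<open>m < -2\<close> the denominator is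
  negative, so there \<open>rho_minus\<close> is the larger root.\<close>

definition rho_minus :: "real \<Rightarrow> real" where
  "rho_minus m = (- m\<^sup>2 + m + 3 - sqrt (disc m)) / (m + 2)"

definition rho_plus :: "real \<Rightarrow> real" where
  "rho_plus m = (- m\<^sup>2 + m + 3 + sqrt (disc m)) / (m + 2)"

lemma rho_poly_factor:
  assumes "m \<noteq> -2" "disc m \<ge> 0"
  shows "rho_poly m \<rho> = (m + 2) * (\<rho> - rho_minus m) * (\<rho> - rho_plus m)"
proof -
  define k where "k = m + 2"
  have k: "k \<noteq> 0" using assms by (auto simp: k_def)
  have "k * rho_minus m = (- m\<^sup>2 + m + 3) - sqrt (disc m)" "k * rho_plus m = (- m\<^sup>2 + m + 3) + sqrt (disc m)"
    using k by (simp_all add: rho_minus_def rho_plus_def flip: k_def)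
  then have e: "k * (\<rho> - rho_minus m) = (k * \<rho> - (- m\<^sup>2 + m + 3)) + sqrt (disc m)"
    "k * (\<rho> - rho_plus m) = (k * \<rho> - (- m\<^sup>2 + m + 3)) - sqrt (disc m)"
    by (simp_all add: right_diff_distrib)
  have "(k * (\<rho> - rho_minus m)) * (k * (\<rho> - rho_plus m)) = (k * \<rho> - (- m\<^sup>2 + m + 3))\<^sup>2 - disc m"
    unfolding e using assms(2) by (simp add: algebra_simps power2_eq_square)
  also have "\<dots> = k * rho_poly m \<rho>"
    unfolding rho_poly_square k_def by simp
  finally have "k * (k * (\<rho> - rho_minus m) * (\<rho> - rho_plus m)) = k * rho_poly m \<rho>"
    by (simp add: mult_ac)
  then show ?thesis
    using k by (simp add: k_def)
qed

lemma rho_poly_root_iff: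
  assumes "m \<noteq> -2" "disc m \<ge> 0"
  shows "rho_poly m \<rho> = 0 \<longleftrightarrow> \<rho> = rho_minus m \<or> \<rho> = rho_plus m"
  using assms by (auto simp: rho_poly_factor)

lemma disc_nonneg: "rho_poly m \<rho> = 0 \<Longrightarrow> disc m \<ge> 0"
  using rho_poly_square[of m \<rho>] zero_le_power2[of "(m + 2) * \<rho> - (- m\<^sup>2 + m + 3)"] by simp

lemma rho_minus_less_rho_plus: "m > -2 \<Longrightarrow> disc m > 0 \<Longrightarrow> rho_minus m < rho_plus m"
  by (simp add: rho_minus_def rho_plus_def divide_strict_right_mono)

lemma rho_plus_less_rho_minus: "m < -2 \<Longrightarrow> disc m > 0 \<Longrightarrow> rho_plus m < rho_minus m"
  by (simp add: rho_minus_def rho_plus_def divide_strict_right_mono_neg)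

lemma distance_pos_iff:
  assumes "rho_poly m \<rho> = 0" "m \<noteq> -2" "m \<noteq> -1/2" "m \<noteq> 0"
  shows "sigma_sq m \<rho> > 4 * \<rho> \<longleftrightarrow> m * (2 + m) * \<rho> > 0"
proof -
  have "1 + \<rho> \<noteq> 0"
    using rho_poly_minus_one[of m] assms(1,2) by (auto simp: add_eq_0_iff)
  \<comment> \<open>Multiplied by \<open>m\<close>, the second relation has a nonzero square on one
    side, so the two factors on the other side have equal signs.\<close>
  then have "0 < (m * (1 + \<rho>))\<^sup>2"
    using assms(4) by simp
  also have "(m * (1 + \<rho>))\<^sup>2 = m * (m * (1 + \<rho>)\<^sup>2)"
    by (simp add: power2_eq_square mult_ac)
  also have "m * (1 + \<rho>)\<^sup>2 = (2 + m) * \<rho> * (sigma_sq m \<rho> - 4 * \<rho>)"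
    using sigma_sq_relations(2)[OF assms(1-3)] by (simp add: power2_eq_square algebra_simps)
  also have "m * ((2 + m) * \<rho> * (sigma_sq m \<rho> - 4 * \<rho>)) = m * (2 + m) * \<rho> * (sigma_sq m \<rho> - 4 * \<rho>)"
    by (simp only: mult.assoc)
  finally show ?thesis
    using zero_less_mult_iff[of "m * (2 + m) * \<rho>" "sigma_sq m \<rho> - 4 * \<rho>"] by auto
qed

lemma admissible_cases: "\<rho> \<in> admissible m \<Longrightarrow> m \<noteq> -2 \<and> m \<noteq> -1/2 \<and> rho_poly m \<rho> = 0 \<and> disc m \<ge> 0"
  using disc_nonneg by (auto simp: admissible_def sigma_sq_def)

text \<open>For positive \<open>\<rho>\<close> the inequality
  \<open>sigma_sq m \<rho> > 4 * \<rho>\<close> implies \<open>sigma_sq m \<rho> > 0\<close>, so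
  only signs matter.\<close>

lemma admissible_pos_iff:
  assumes "\<rho> > 0" "m \<noteq> -2" "m \<noteq> -1/2" "m \<noteq> 0"
  shows "\<rho> \<in> admissible m \<longleftrightarrow> rho_poly m \<rho> = 0 \<and> m * (2 + m) > 0"
proof (cases "rho_poly m \<rho> = 0")
  case True
  then show ?thesis
    using distance_pos_iff[OF True assms(2-4)] assms(1) by (auto simp: admissible_def zero_less_mult_iff)
qed (simp add: admissible_def)

lemma admissible_neg_iff:
  assumes "\<rho> < 0" "m \<noteq> -2" "m \<noteq> -1/2" "m \<noteq> 0"
  shows "\<rho> \<in> admissible m \<longleftrightarrow> rho_poly m \<rho> = 0 \<and> m * (2 + m) < 0 \<and> sigma_sq m \<rho> > 0"
proof (cases "rho_poly m \<rho> = 0")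
  case True
  then show ?thesis
    using distance_pos_iff[OF True assms(2-4)] assms(1) by (auto simp: admissible_def zero_less_mult_iff mult_less_0_iff)
qed (simp add: admissible_def)

section \<open>Location of the roots and their admissibility, for the ranges not involving the
  cubic\<close>

lemma disc_pos_middle: "-1 < m \<Longrightarrow> m < 1 \<Longrightarrow> disc m > 0"
proof -
  assume m: "-1 < m" "m < 1"
  have "m\<^sup>2 < 1" using m by (simp add: abs_square_less_1)
  then show ?thesis
    using m unfolding disc_def by (intro mult_neg_neg) linarith+
qed

text \<open>The negative zero of the second factor of \<open>disc\<close> is
  \<open>2 - sqrt 13\<close>, about -1.606; the bound is a convenient number between
  \<open>m_tilde\<close> and this zero.\<close>

lemma disc_pos_left:
  assumes "m \<le> -168/100"
  shows "disc m > 0"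
proof -
  have "(168/100)\<^sup>2 \<le> (- m)\<^sup>2"
    using assms by (intro power_mono) auto
  then have "m\<^sup>2 \<ge> 28224/10000" by (simp add: power2_eq_square)
  then show ?thesis
    using assms unfolding disc_def by (intro mult_pos_pos) linarith+
qed

lemma rho_pos_unit:
  assumes "0 < m" "m \<le> 1" "rho_poly m \<rho> = 0"
  shows "\<rho> > 0"
proof (rule ccontr)
  assume "\<not> \<rho> > 0"
  then have "2 * (m\<^sup>2 - m - 3) * \<rho> \<ge> 0"
    using assms power_le_one[of m 2] by (intro mult_nonpos_nonpos) auto
  moreover have "m * (2 * m + 1) > 0" "(m + 2) * \<rho>\<^sup>2 \<ge> 0"
    using assms by simp_all
  ultimately show False
    using assms(3) by (simp add: rho_poly_def)
qed

lemma admissible_unit: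
  assumes "0 < m" "m < 1"
  shows "admissible m = {rho_minus m, rho_plus m}" "rho_minus m < rho_plus m" "rho_minus m > 0"
proof -
  have D: "disc m > 0" using assms disc_pos_middle by simp
  show "rho_minus m < rho_plus m"
    using rho_minus_less_rho_plus D assms by simp
  have "\<rho> \<in> admissible m \<longleftrightarrow> rho_poly m \<rho> = 0" for \<rho>
    using rho_pos_unit[of m \<rho>] admissible_pos_iff[of \<rho> m] admissible_cases[of \<rho> m] assms by auto
  then show "admissible m = {rho_minus m, rho_plus m}"
    using rho_poly_root_iff[of m] D assms by auto
  show "rho_minus m > 0"
    using rho_pos_unit[of m] rho_poly_root_iff[of m] D assms by simp
qed

lemma admissible_one: "admissible 1 = {1}"
proof -
  have "rho_poly 1 \<rho> = 3 * (\<rho> - 1)\<^sup>2" for \<rho>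
    by (simp add: rho_poly_def power2_eq_square algebra_simps)
  then show ?thesis
    by (auto simp: admissible_def sigma_sq_def)
qed

lemma rho_minus_zero: "rho_minus 0 = 0"
  by (simp add: rho_minus_def disc_def)

text \<open>The roots are 0 and 3. At 3 one has \<open>sigma_sq = 12 = 4 * 3\<close>, that is
  \<open>y3 = y4\<close>: the second family ends at \<open>m = 0\<close> in a collision of vortices
  3 and 4.\<close>

lemma admissible_zero: "admissible 0 = {rho_minus 0}"
proof -
  have "rho_poly 0 \<rho> = 2 * \<rho> * (\<rho> - 3)" for \<rho>
    by (simp add: rho_poly_def power2_eq_square algebra_simps)
  then show ?thesis
    unfolding rho_minus_zero by (auto simp: admissible_def sigma_sq_def)
qed

lemma rho_minus_neg:
  assumes "-1/2 < m" "m < 0"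
  shows "rho_minus m < 0" "rho_plus m > 0" "rho_minus m > -1/4"
proof -
  have D: "disc m > 0" and m2: "m \<noteq> -2" using assms disc_pos_middle by auto
  have lt: "rho_minus m < rho_plus m"
    using rho_minus_less_rho_plus D assms by simp
  have "rho_poly m 0 < 0"
    using assms by (simp add: rho_poly_def mult_less_0_iff)
  then have "rho_minus m * rho_plus m < 0"
    using rho_poly_factor[OF m2, of 0] D assms by (simp add: mult_less_0_iff zero_less_mult_iff)
  then show neg: "rho_minus m < 0" "rho_plus m > 0"
    using lt by (auto simp: mult_less_0_iff)
  \<comment> \<open>A positive value at -1/4 and a negative one at 0 confine the negative root. The
    bound -1/4 is what the positivity of \<open>sigma_sq\<close> requires later.\<close>
  have "rho_poly m (-1/4) = (m + 2) / 16 + 3/2 * (m\<^sup>2 + (m + 1))"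
    by (simp add: rho_poly_def power2_eq_square algebra_simps)
  also have "\<dots> > 0"
  proof (rule add_pos_pos)
    have "0 < m + 1" using assms by simp
    then show "0 < 3/2 * (m\<^sup>2 + (m + 1))"
      by (simp add: add_nonneg_pos)
  qed (use assms in simp)
  finally have "rho_poly m (-1/4) > 0" .
  then have "(-1/4 - rho_minus m) * (-1/4 - rho_plus m) > 0"
    using rho_poly_factor[OF m2, of "-1/4"] D assms by (simp add: zero_less_mult_iff mult_less_0_iff)
  then show "rho_minus m > -1/4"
    using neg by (auto simp: zero_less_mult_iff)
qed

lemma admissible_negative_mass:
  assumes "-1/2 < m" "m < 0"
  shows "admissible m = {rho_minus m}"
proof -
  have D: "disc m > 0" and m: "m \<noteq> -2" "m \<noteq> -1/2" "m \<noteq> 0" using assms disc_pos_middle by auto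
  note \<rho> = rho_minus_neg[OF assms]
  have mm: "m * (2 + m) < 0" using assms by (simp add: mult_less_0_iff)
  have root: "rho_poly m (rho_minus m) = 0"
    using rho_poly_root_iff[of m] D m by simp
  \<comment> \<open>With \<open>-1/4 < \<rho> < 0\<close>, the right side of the first relation is
    at least \<open>3 - 3/2 - 1/16\<close>.\<close>
  have "(rho_minus m)\<^sup>2 \<le> (1/4)\<^sup>2"
    using \<rho> by (simp add: abs_le_square_iff[symmetric])
  moreover have "(6 + 8 * m) * rho_minus m \<ge> 6 * (-1/4)"
  proof -
    have "(6 + 8 * m) * (- rho_minus m) \<le> 6 * (1/4)"
      using assms \<rho> by (intro mult_mono) auto
    then show ?thesis by simp
  qed
  ultimately have "3 + (6 + 8 * m) * rho_minus m - (rho_minus m)\<^sup>2 > 0"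
    by (simp add: power2_eq_square)
  then have "(1 + 2 * m) * sigma_sq m (rho_minus m) > 0"
    unfolding sigma_sq_relations(1)[OF root m(1,2)] .
  then have "sigma_sq m (rho_minus m) > 0"
    using assms by (simp add: zero_less_mult_iff)
  then have "rho_minus m \<in> admissible m"
    using admissible_neg_iff[OF \<rho>(1) m] root mm by simp
  moreover have "rho_plus m \<notin> admissible m"
    using admissible_pos_iff[OF \<rho>(2) m] mm by simp
  ultimately show ?thesis
    using admissible_cases rho_poly_root_iff[of m] by blast
qed

text \<open>The leading coefficient is negative and the value at 0 positive, so the roots have
  opposite signs. As \<open>m * (2 + m) > 0\<close>, the positive one is admissible and the negative
  one is not.\<close>

lemma admissible_left:
  assumes "m < -2"
  shows "admissible m = {rho_minus m}" "rho_minus m > 0"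
proof -
  have D: "disc m > 0" and m: "m \<noteq> -2" "m \<noteq> -1/2" "m \<noteq> 0" using assms disc_pos_left by auto
  have lt: "rho_plus m < rho_minus m"
    using rho_plus_less_rho_minus D assms by simp
  have "rho_poly m 0 > 0"
    using assms by (simp add: rho_poly_def zero_less_mult_iff)
  moreover have "rho_poly m 0 = (m + 2) * (rho_minus m * rho_plus m)"
    using rho_poly_factor[OF m(1), of 0] D by simp
  ultimately have "rho_minus m * rho_plus m < 0"
    using zero_less_mult_iff[of "m + 2" "rho_minus m * rho_plus m"] assms by auto
  then show \<rho>: "rho_minus m > 0"
    using lt by (auto simp: mult_less_0_iff)
  then have "rho_plus m < 0"
    using \<open>rho_minus m * rho_plus m < 0\<close> by (simp add: mult_less_0_iff)
  moreover have "m * (2 + m) > 0"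
    using assms by (simp add: zero_less_mult_iff)
  moreover have "rho_poly m (rho_minus m) = 0"
    using rho_poly_root_iff[of m] D m by simp
  ultimately show "admissible m = {rho_minus m}"
    using admissible_pos_iff[OF \<rho> m] admissible_neg_iff[of "rho_plus m" m] m
      admissible_cases[of _ m] rho_poly_root_iff[of m] by auto
qed

section \<open>The cubic, its root, and the masses where it decides\<close>

definition cubic :: "real \<Rightarrow> real" where
  "cubic x = 5 * x ^ 3 + 7 * x\<^sup>2 + 3 * x + 9"

lemma cubic_pos: "x \<ge> -1 \<Longrightarrow> cubic x > 0"
proof -
  assume x: "x \<ge> -1"
  \<comment> \<open>Expanded at -1, the cubic is 8 plus \<open>u\<close> times a quadratic without
    real zeros.\<close>
  define u where "u = x + 1"
  have "5 * u\<^sup>2 - 8 * u + 4 = 5 * (u - 4/5)\<^sup>2 + 4/5"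
    by (simp add: power2_eq_square algebra_simps)
  then have "u * (5 * u\<^sup>2 - 8 * u + 4) \<ge> 0"
    using x by (simp add: u_def)
  moreover have "cubic x = u * (5 * u\<^sup>2 - 8 * u + 4) + 8"
    by (simp add: cubic_def u_def power2_eq_square power3_eq_cube algebra_simps)
  ultimately show ?thesis by simp
qed

lemma cubic_strict_mono:
  assumes "x < y" "y \<le> -1"
  shows "cubic x < cubic y"
proof -
  \<comment> \<open>In the distances to the left of -1, the difference quotient has positive
    coefficients only.\<close>
  define u v where "u = -1 - x" and "v = -1 - y"
  have uv: "u \<ge> 0" "v \<ge> 0" "u > v" using assms by (auto simp: u_def v_def)
  have "cubic y - cubic x = (u - v) * (4 + 8 * (u + v) + 5 * (u\<^sup>2 + u * v + v\<^sup>2))"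
    by (simp add: cubic_def u_def v_def power2_eq_square power3_eq_cube algebra_simps)
  also have "\<dots> > 0"
    using uv by (intro mult_pos_pos) (auto intro!: add_pos_nonneg)
  finally show ?thesis by simp
qed

lemma cubic_root: "\<exists>!x. cubic x = 0" "cubic m_tilde = 0" "-1.68045 < m_tilde" "m_tilde < -1.68035"
proof -
  \<comment> \<open>The ends are -1.6804 -/+ 0.00005, the claimed accuracy; that they are not roots
    makes the bounds strict.\<close>
  have "\<exists>x\<ge>-1.68045. x \<le> -1.68035 \<and> cubic x = 0"
    by (rule IVT) (auto simp: cubic_def power2_eq_square power3_eq_cube intro!: continuous_intros)
  then obtain x where x: "-1.68045 \<le> x" "x \<le> -1.68035" "cubic x = 0" by blast
  have ne: "cubic (-1.68045) \<noteq> 0" "cubic (-1.68035) \<noteq> 0"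
    by (simp_all add: cubic_def power2_eq_square power3_eq_cube)
  have unique: "y = x" if "cubic y = 0" for y
    using that x linear[of y "-1"] cubic_pos[of y] cubic_strict_mono[of x y] cubic_strict_mono[of y x]
    by (cases y x rule: linorder_cases) auto
  show "\<exists>!x. cubic x = 0"
    using x(3) unique by blast
  have "m_tilde = x"
    unfolding m_tilde_def using x(3) unique unfolding cubic_def by blast
  then show "cubic m_tilde = 0" "-1.68045 < m_tilde" "m_tilde < -1.68035"
    using x ne by (auto simp: less_le)
qed

lemma cubic_neg: "m < m_tilde \<Longrightarrow> cubic m < 0"
  using cubic_strict_mono[of m m_tilde] cubic_root by simp

lemma cubic_nonneg: "m \<ge> m_tilde \<Longrightarrow> cubic m \<ge> 0"
  using cubic_strict_mono[of m_tilde m] cubic_pos[of m] cubic_root by (cases "m = m_tilde"; cases "m \<ge> -1") auto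

text \<open>Expanded in powers of \<open>\<rho> + 1\<close>, the polynomial has only positive
  coefficients for these \<open>m\<close>, hence no root from -1 on. Besides convexity this keeps
  the kites in the region where the product of the coordinates is below -1.\<close>

lemma rho_less_minus_one:
  assumes "-2 < m" "m \<le> -1.6" "rho_poly m \<rho> = 0"
  shows "\<rho> < -1"
proof (rule ccontr)
  assume "\<not> \<rho> < -1"
  have "(16/10)\<^sup>2 \<le> (- m)\<^sup>2"
    using assms by (intro power_mono) auto
  then have "m\<^sup>2 - 2 * m - 5 > 0"
    using assms by (simp add: power2_eq_square)
  then have "(m + 2) * (\<rho> + 1)\<^sup>2 + 2 * (\<rho> + 1) * (m\<^sup>2 - 2 * m - 5) + 4 * (m + 2) > 0"
    using \<open>\<not> \<rho> < -1\<close> assms by (intro add_nonneg_pos[OF add_nonneg_nonneg]) simp_all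
  moreover have "rho_poly m \<rho> = (m + 2) * (\<rho> + 1)\<^sup>2 + 2 * (\<rho> + 1) * (m\<^sup>2 - 2 * m - 5) + 4 * (m + 2)"
    by (simp add: rho_poly_def power2_eq_square algebra_simps)
  ultimately show False
    using assms(3) by simp
qed

text \<open>Up to a factor that is negative for \<open>-2 < m < -1/2\<close>, \<open>x\<close> below is \<open>\<sigma>\<^sup>2\<close>; so the sign of
  the cubic decides whether the zero of \<open>\<sigma>\<^sup>2\<close>, as a function of \<open>\<rho>\<close>, lies between the two roots.\<close>

lemma rho_poly_shift:
  fixes m \<rho> :: real
  defines "k \<equiv> 5 * m\<^sup>2 + 10 * m + 3" and "n \<equiv> m\<^sup>2 + 2 * m + 3"
  defines "x \<equiv> k * \<rho> + n"
  shows "k\<^sup>2 * rho_poly m \<rho> = (m + 2) * x\<^sup>2 - 2 * (m + 1) * (- 5 * m ^ 3 + m\<^sup>2 + 25 * m + 15) * x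
    + 4 * (m + 2) * (m + 1) * (2 * m + 1) * cubic m"
  by (simp add: k_def n_def x_def rho_poly_def cubic_def power2_eq_square power3_eq_cube algebra_simps)

lemma sigma_sq_pos_iff:
  assumes "-2 < m" "m < -1/2"
  shows "sigma_sq m \<rho> > 0 \<longleftrightarrow> (5 * m\<^sup>2 + 10 * m + 3) * \<rho> + (m\<^sup>2 + 2 * m + 3) < 0"
    and "sigma_sq m \<rho> = 0 \<longleftrightarrow> (5 * m\<^sup>2 + 10 * m + 3) * \<rho> + (m\<^sup>2 + 2 * m + 3) = 0"
proof -
  have "(2 * m + 1) * (m + 2) < 0"
    using assms by (simp add: mult_less_0_iff)
  moreover have "sigma_sq m \<rho> = 2 * ((5 * m\<^sup>2 + 10 * m + 3) * \<rho> + (m\<^sup>2 + 2 * m + 3)) / ((2 * m + 1) * (m + 2))"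
    by (simp add: sigma_sq_def add.assoc)
  moreover have "D < 0 \<Longrightarrow> (2 * E / D > 0 \<longleftrightarrow> E < 0) \<and> (2 * E / D = 0 \<longleftrightarrow> E = 0)" for D E :: real
    by (auto simp: zero_less_divide_iff)
  ultimately show "sigma_sq m \<rho> > 0 \<longleftrightarrow> (5 * m\<^sup>2 + 10 * m + 3) * \<rho> + (m\<^sup>2 + 2 * m + 3) < 0"
    "sigma_sq m \<rho> = 0 \<longleftrightarrow> (5 * m\<^sup>2 + 10 * m + 3) * \<rho> + (m\<^sup>2 + 2 * m + 3) = 0"
    by presburger+
qed

text \<open>As a function of \<open>\<rho>\<close>, \<open>sigma_sq\<close> is strictly decreasing
  here, because \<open>k > 0\<close> and its denominator is negative. Its zero
  \<open>- n / k\<close> lies strictly between the roots, so exactly the smaller root makes it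
  positive.\<close>

lemma admissible_convex:
  assumes "-2 < m" "m < m_tilde"
  shows "admissible m = {rho_minus m}" "rho_minus m < -1"
proof -
  define k n where "k = 5 * m\<^sup>2 + 10 * m + 3" and "n = m\<^sup>2 + 2 * m + 3"
  have m: "m \<noteq> -2" "m \<noteq> -1/2" "m \<noteq> 0" "m < -1.68035" using assms cubic_root by auto
  have D: "disc m > 0" using m(4) disc_pos_left by simp
  have lt: "rho_minus m < rho_plus m"
    using rho_minus_less_rho_plus D assms by simp
  have root: "rho_poly m \<rho> = 0 \<longleftrightarrow> \<rho> = rho_minus m \<or> \<rho> = rho_plus m" for \<rho>
    using rho_poly_root_iff[of m] D m by simp
  show \<rho>: "rho_minus m < -1"
    using rho_less_minus_one[of m "rho_minus m"] root assms m(4) by simp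
  have \<rho>': "rho_plus m < -1"
    using rho_less_minus_one[of m "rho_plus m"] root assms m(4) by simp
  \<comment> \<open>Note \<open>k = 5 * (m + 1)\<^sup>2 - 2\<close>.\<close>
  have "(m + 1)\<^sup>2 \<ge> (68/100)\<^sup>2"
    using m(4) power_mono[of "68/100" "- (m + 1)" 2] by (simp add: power2_eq_square algebra_simps)
  then have k: "k > 0"
    by (simp add: k_def power2_eq_square algebra_simps)
  have "k * (- n / k) + n = 0"
    using k by simp
  \<comment> \<open>At the zero of \<open>sigma_sq\<close> only the constant term of the shifted
    polynomial remains; there the three linear factors have positive product and the cubic is
    negative.\<close>
  then have "k\<^sup>2 * rho_poly m (- n / k) = 4 * (m + 2) * (m + 1) * (2 * m + 1) * cubic m"
    using rho_poly_shift[of m "- n / k"] by (simp flip: k_def n_def)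
  also have "\<dots> < 0"
    using cubic_neg[OF assms(2)] assms(1) m(4) by (auto simp: mult_less_0_iff zero_less_mult_iff)
  finally have "rho_poly m (- n / k) < 0"
    using k by (simp add: mult_less_0_iff)
  then have "(- n / k - rho_minus m) * (- n / k - rho_plus m) < 0"
    using rho_poly_factor[OF m(1), of "- n / k"] D assms by (simp add: mult_less_0_iff zero_less_mult_iff)
  then have "rho_minus m < - n / k" "- n / k < rho_plus m"
    using lt unfolding mult_less_0_iff by linarith+
  then have "k * rho_minus m + n < 0" "\<not> k * rho_plus m + n < 0"
    using k by (simp_all add: pos_less_minus_divide_eq pos_minus_divide_less_eq field_simps)
  then have "sigma_sq m (rho_minus m) > 0" "\<not> sigma_sq m (rho_plus m) > 0"
    using sigma_sq_pos_iff(1)[of m] assms m(4) by (auto simp: k_def n_def)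
  moreover have "m * (2 + m) < 0"
    using assms m(4) by (simp add: mult_less_0_iff)
  ultimately have "rho_minus m \<in> admissible m" "rho_plus m \<notin> admissible m"
    using admissible_neg_iff[of _ m] m(1-3) \<rho> \<rho>' root by simp_all
  then show "admissible m = {rho_minus m}"
    using root admissible_cases by blast
qed

lemma auxiliary_cubic_neg:
  fixes m :: real
  assumes "-1.7 \<le> m" "m \<le> -1.6"
  shows "- 5 * m ^ 3 + m\<^sup>2 + 25 * m + 15 < 0"
proof -
  \<comment> \<open>Polynomial division by \<open>(m + 1.7) * (m + 1.6)\<close>, which is
    nonpositive on the interval. The quotient is positive, and the linear remainder is negative,
    narrowly so at -1.7.\<close>
  have "(m + 1.7) * (m + 1.6) \<le> 0"
    using assms by (intro mult_nonneg_nonpos) auto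
  then have "(m + 1.7) * (m + 1.6) * (17.5 - 5 * m) \<le> 0"
    by (rule mult_nonpos_nonneg) (use assms in simp)
  moreover have "- 5 * m ^ 3 + m\<^sup>2 + 25 * m + 15 = (m + 1.7) * (m + 1.6) * (17.5 - 5 * m) + (- 19.15 * m - 32.6)"
    by (simp add: power2_eq_square power3_eq_cube field_simps)
  ultimately show ?thesis
    using assms by simp
qed

text \<open>For \<open>m > 1\<close> and for \<open>-1 < m < -1/2\<close> the sign of
  \<open>\<rho>\<close> contradicts the sign condition on \<open>m * (2 + m)\<close>. Left of -1, a
  real root forces \<open>m \<le> -1.6\<close>, and then the shifted polynomial is positive wherever
  \<open>sigma_sq > 0\<close>.\<close>

lemma admissible_empty:
  assumes "m \<notin> {1} \<union> {-1/2<..<1} \<union> {-2<..<m_tilde} \<union> {..< -2}"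
  shows "admissible m = {}"
proof (rule ccontr)
  assume "admissible m \<noteq> {}"
  then obtain \<rho> where \<rho>: "\<rho> \<in> admissible m" by blast
  then have m: "m \<noteq> -2" "m \<noteq> -1/2" "rho_poly m \<rho> = 0" "disc m \<ge> 0"
    using admissible_cases by auto
  consider "m > 1" | "-1 < m" "m < -1/2" | "m = -1" | "m_tilde \<le> m" "m < -1"
    using assms m by force
  then show False
  proof cases
    case 1
    then have "m\<^sup>2 > 1" by (simp add: one_less_power)
    then have "m\<^sup>2 - 4 * m - 9 \<ge> 0"
      using m(4) unfolding disc_def by (simp add: zero_le_mult_iff)
    then have q: "m\<^sup>2 - m - 3 > 0" using 1 by linarith
    have "\<rho> < 0"
    proof (rule ccontr)
      assume "\<not> \<rho> < 0"
      then have "(m + 2) * \<rho>\<^sup>2 + 2 * (m\<^sup>2 - m - 3) * \<rho> \<ge> 0" "m * (2 * m + 1) > 0"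
        using 1 q by simp_all
      then show False using m(3) by (simp add: rho_poly_def)
    qed
    then have "m * (2 + m) < 0"
      using admissible_neg_iff[of \<rho> m] \<rho> 1 m by (cases "m = 0") auto
    then show False
      using 1 by (simp add: mult_less_0_iff)
  next
    case 2
    have "\<rho> > 0"
    proof (rule ccontr)
      assume "\<not> \<rho> > 0"
      moreover have "m\<^sup>2 < 1" using 2 by (simp add: abs_square_less_1)
      ultimately have "2 * (m\<^sup>2 - m - 3) * \<rho> \<ge> 0"
        using 2 by (intro mult_nonpos_nonpos) auto
      moreover have "m * (2 * m + 1) > 0" "(m + 2) * \<rho>\<^sup>2 \<ge> 0"
        using 2 by (simp_all add: zero_less_mult_iff)
      ultimately show False using m(3) by (simp add: rho_poly_def)
    qed
    moreover have "m * (2 + m) < 0" using 2 by (simp add: mult_less_0_iff)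
    ultimately show False
      using admissible_pos_iff[of \<rho> m] \<rho> 2 m by simp
  next
    case 3
    then have "\<exists>p. p \<in> solutions (-1)"
      using \<rho> card_solutions[of "-1"] finite_admissible[of "-1"] 
      by (metis card_0_eq card.empty emptyE equals0I mult_eq_0_iff zero_neq_numeral)
    then show False using solutions_minus_one by auto
  next
    case 4
    have 5: "m > -1.68045" using 4 cubic_root by simp
    have "(- 1)\<^sup>2 < m\<^sup>2"
      using 4 power_strict_mono[of 1 "- m" 2] by simp
    then have "m\<^sup>2 - 4 * m - 9 \<ge> 0"
      using m(4) unfolding disc_def by (simp add: zero_le_mult_iff)
    \<comment> \<open>The factor is already negative at -1.6, its zero being
      \<open>2 - sqrt 13\<close>.\<close>
    then have 6: "m \<le> -1.6"
    proof (rule contrapos_pp)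
      assume "\<not> m \<le> -1.6"
      moreover have "(- m)\<^sup>2 \<le> (16/10)\<^sup>2"
        using 4 \<open>\<not> m \<le> -1.6\<close> by (intro power_mono) auto
      ultimately show "\<not> m\<^sup>2 - 4 * m - 9 \<ge> 0"
        by (simp add: power2_eq_square)
    qed
    have "\<rho> < -1"
      using rho_less_minus_one[OF _ 6 m(3)] 5 by simp
    \<comment> \<open>Positive \<open>sigma_sq\<close> means \<open>x < 0\<close>; then every term
      of the polynomial in \<open>x\<close> is nonnegative and the first one is positive, so it
      cannot vanish.\<close>
    define x where "x = (5 * m\<^sup>2 + 10 * m + 3) * \<rho> + (m\<^sup>2 + 2 * m + 3)"
    have "x < 0"
      using sigma_sq_pos_iff(1)[of m \<rho>] \<rho> 4 5 by (simp add: admissible_def x_def)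
    then have "(m + 2) * x\<^sup>2 > 0" using 5 by simp
    moreover have "(m + 1) * (- 5 * m ^ 3 + m\<^sup>2 + 25 * m + 15) > 0"
      using auxiliary_cubic_neg[of m] 5 6 4 by (intro mult_neg_neg) auto
    then have "(2 * ((m + 1) * (- 5 * m ^ 3 + m\<^sup>2 + 25 * m + 15))) * x < 0"
      by (intro mult_pos_neg[OF _ \<open>x < 0\<close>]) simp
    then have "2 * (m + 1) * (- 5 * m ^ 3 + m\<^sup>2 + 25 * m + 15) * x < 0"
      by (simp only: mult.assoc)
    moreover have "(m + 2) * (m + 1) * (2 * m + 1) > 0"
      using 4 5 by (simp add: zero_less_mult_iff mult_less_0_iff)
    then have "4 * ((m + 2) * (m + 1) * (2 * m + 1)) * cubic m \<ge> 0"
      by (intro mult_nonneg_nonneg[of "4 * _"] cubic_nonneg 4(1)) linarith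
    then have "4 * (m + 2) * (m + 1) * (2 * m + 1) * cubic m \<ge> 0"
      by (simp only: mult.assoc)
    ultimately show False
      using rho_poly_shift[of m \<rho>] m(3) by (simp flip: x_def)
  qed
qed

section \<open>Smooth families\<close>


text \<open>Finite-order form of \<open>smooth_on\<close>: the derivatives of order below
  \<open>n\<close> are differentiable on \<open>I\<close>. Recursion through the first derivative
  makes the closure properties provable by induction on \<open>n\<close>.\<close>

primrec times_differentiable_on :: "nat \<Rightarrow> real set \<Rightarrow> (real \<Rightarrow> real) \<Rightarrow> bool" where
  "times_differentiable_on 0 I f = True"
| "times_differentiable_on (Suc n) I f =
    ((\<forall>x\<in>I. f differentiable (at x)) \<and> times_differentiable_on n I (deriv f))"

lemma smooth_on_iff: "smooth_on I f \<longleftrightarrow> (\<forall>n. times_differentiable_on n I f)"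
proof -
  have "times_differentiable_on n I f \<longleftrightarrow> (\<forall>k<n. \<forall>x\<in>I. ((deriv ^^ k) f) differentiable (at x))" for n
    by (induction n arbitrary: f) (auto simp: All_less_Suc2 funpow_Suc_right simp del: funpow.simps)
  then show ?thesis
    unfolding smooth_on_def by blast
qed

context
  fixes I :: "real set"
  assumes I: "open I"
begin

text \<open>Openness of \<open>I\<close> enters here: \<open>deriv\<close> at a point of
  \<open>I\<close> only sees nearby values, which are taken inside \<open>I\<close>.\<close>

lemma times_differentiable_on_cong:
  assumes "\<And>x. x \<in> I \<Longrightarrow> f x = g x" "times_differentiable_on n I f"
  shows "times_differentiable_on n I g"
  using assms
proof (induction n arbitrary: f g)
  case (Suc n)
  have g: "(g has_field_derivative deriv f x) (at x)" if "x \<in> I" for x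
  proof -
    have "(f has_field_derivative deriv f x) (at x)"
      using Suc.prems(2) that by (simp add: DERIV_deriv_iff_real_differentiable)
    then show ?thesis
      by (rule has_field_derivative_transform_within_open[OF _ I that]) (use Suc.prems(1) in auto)
  qed
  then have "deriv f x = deriv g x" if "x \<in> I" for x
    using that by (metis DERIV_imp_deriv)
  then have "times_differentiable_on n I (deriv g)"
    using Suc.IH[of "deriv f" "deriv g"] Suc.prems(2) by auto
  then show ?case
    using g by (auto simp: real_differentiable_def)
qed simp

text \<open>Any function that is the derivative on \<open>I\<close> may stand in for
  \<open>deriv f\<close>, whose values outside \<open>I\<close> are not under control.\<close>

lemma times_differentiable_on_SucI:
  assumes "\<And>x. x \<in> I \<Longrightarrow> (f has_field_derivative f' x) (at x)" "times_differentiable_on n I f'"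
  shows "times_differentiable_on (Suc n) I f"
proof -
  have "f' x = deriv f x" if "x \<in> I" for x
    using DERIV_imp_deriv[OF assms(1)[OF that]] by simp
  then have "times_differentiable_on n I (deriv f)"
    by (rule times_differentiable_on_cong[OF _ assms(2)])
  then show ?thesis
    using assms(1) by (auto simp: real_differentiable_def)
qed

lemma times_differentiable_on_SucD:
  assumes "times_differentiable_on (Suc n) I f"
  shows "\<exists>f'. (\<forall>x\<in>I. (f has_field_derivative f' x) (at x)) \<and> times_differentiable_on n I f'"
  using assms by (auto simp: DERIV_deriv_iff_real_differentiable intro!: exI[of _ "deriv f"])

lemma times_differentiable_on_Suc: "times_differentiable_on (Suc n) I f \<Longrightarrow> times_differentiable_on n I f"
  by (induction n arbitrary: f) auto

lemma times_differentiable_on_const: "times_differentiable_on n I (\<lambda>x. c)"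
proof (induction n arbitrary: c)
  case (Suc n)
  then show ?case
    by (intro times_differentiable_on_SucI[of _ "\<lambda>x. 0"]) auto
qed simp

lemma times_differentiable_on_add:
  assumes "times_differentiable_on n I f" "times_differentiable_on n I g"
  shows "times_differentiable_on n I (\<lambda>x. f x + g x)"
  using assms
proof (induction n arbitrary: f g)
  case (Suc n)
  obtain f' where f: "\<And>x. x \<in> I \<Longrightarrow> (f has_field_derivative f' x) (at x)" "times_differentiable_on n I f'"
    using times_differentiable_on_SucD[OF Suc.prems(1)] by blast
  obtain g' where g: "\<And>x. x \<in> I \<Longrightarrow> (g has_field_derivative g' x) (at x)" "times_differentiable_on n I g'"
    using times_differentiable_on_SucD[OF Suc.prems(2)] by blast
  show ?case
    by (rule times_differentiable_on_SucI[of _ "\<lambda>x. f' x + g' x"]) (auto intro!: DERIV_add f g Suc.IH)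
qed simp

lemma times_differentiable_on_mult:
  assumes "times_differentiable_on n I f" "times_differentiable_on n I g"
  shows "times_differentiable_on n I (\<lambda>x. f x * g x)"
  using assms
proof (induction n arbitrary: f g)
  case (Suc n)
  obtain f' where f: "\<And>x. x \<in> I \<Longrightarrow> (f has_field_derivative f' x) (at x)" "times_differentiable_on n I f'"
    using times_differentiable_on_SucD[OF Suc.prems(1)] by blast
  obtain g' where g: "\<And>x. x \<in> I \<Longrightarrow> (g has_field_derivative g' x) (at x)" "times_differentiable_on n I g'"
    using times_differentiable_on_SucD[OF Suc.prems(2)] by blast
  show ?case
    by (rule times_differentiable_on_SucI[of _ "\<lambda>x. f x * g' x + f' x * g x"])
      (intro DERIV_mult' f(1) g(1) times_differentiable_on_add Suc.IH f(2) g(2)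
        times_differentiable_on_Suc[OF Suc.prems(1)] times_differentiable_on_Suc[OF Suc.prems(2)] | assumption)+
qed simp

text \<open>The derivative is a product of \<open>f'\<close> and the inverse itself, to which the
  induction hypothesis of lower order applies; the square root below is treated in the same
  way.\<close>

lemma times_differentiable_on_inverse:
  assumes "times_differentiable_on n I f" "\<And>x. x \<in> I \<Longrightarrow> f x \<noteq> 0"
  shows "times_differentiable_on n I (\<lambda>x. inverse (f x))"
  using assms(1)
proof (induction n)
  case (Suc n)
  obtain f' where f: "\<And>x. x \<in> I \<Longrightarrow> (f has_field_derivative f' x) (at x)" "times_differentiable_on n I f'"
    using times_differentiable_on_SucD[OF Suc.prems(1)] by blast
  note inv = Suc.IH[OF times_differentiable_on_Suc[OF Suc.prems]]
  show ?case
  proof (rule times_differentiable_on_SucI)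
    show "((\<lambda>x. inverse (f x)) has_field_derivative (- 1) * (f' x * (inverse (f x) * inverse (f x)))) (at x)"
      if "x \<in> I" for x
      using DERIV_inverse'[OF f(1)[OF that] assms(2)[OF that]] by (simp add: mult_ac)
    show "times_differentiable_on n I (\<lambda>x. (- 1) * (f' x * (inverse (f x) * inverse (f x))))"
      by (intro times_differentiable_on_mult times_differentiable_on_const inv f(2))
  qed
qed simp

lemma times_differentiable_on_sqrt:
  assumes "times_differentiable_on n I f" "\<And>x. x \<in> I \<Longrightarrow> f x > 0"
  shows "times_differentiable_on n I (\<lambda>x. sqrt (f x))"
  using assms(1)
proof (induction n)
  case (Suc n)
  obtain f' where f: "\<And>x. x \<in> I \<Longrightarrow> (f has_field_derivative f' x) (at x)" "times_differentiable_on n I f'"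
    using times_differentiable_on_SucD[OF Suc.prems(1)] by blast
  have inv: "times_differentiable_on n I (\<lambda>x. inverse (sqrt (f x)))"
    by (intro times_differentiable_on_inverse Suc.IH times_differentiable_on_Suc[OF Suc.prems])
      (use assms(2) in force)
  show ?case
  proof (rule times_differentiable_on_SucI)
    show "((\<lambda>x. sqrt (f x)) has_field_derivative (inverse (sqrt (f x)) * (1 / 2)) * f' x) (at x)"
      if "x \<in> I" for x
      using DERIV_chain2[OF DERIV_real_sqrt[OF assms(2)[OF that]] f(1)[OF that]] by simp
    show "times_differentiable_on n I (\<lambda>x. (inverse (sqrt (f x)) * (1 / 2)) * f' x)"
      by (intro times_differentiable_on_mult times_differentiable_on_const inv f(2))
  qed
qed simp

lemma smooth_on_const: "smooth_on I (\<lambda>x. c)"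
  by (simp add: smooth_on_iff times_differentiable_on_const)

lemma smooth_on_ident: "smooth_on I (\<lambda>x. x)"
  unfolding smooth_on_iff
proof
  show "times_differentiable_on n I (\<lambda>x. x)" for n
    by (cases n) (simp_all add: times_differentiable_on_const)
qed

lemma smooth_on_add: "smooth_on I f \<Longrightarrow> smooth_on I g \<Longrightarrow> smooth_on I (\<lambda>x. f x + g x)"
  by (simp add: smooth_on_iff times_differentiable_on_add)

lemma smooth_on_mult: "smooth_on I f \<Longrightarrow> smooth_on I g \<Longrightarrow> smooth_on I (\<lambda>x. f x * g x)"
  by (simp add: smooth_on_iff times_differentiable_on_mult)

lemma smooth_on_minus: "smooth_on I f \<Longrightarrow> smooth_on I (\<lambda>x. - f x)"
  using smooth_on_mult[OF smooth_on_const[of "-1"]] by simp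

lemma smooth_on_diff: "smooth_on I f \<Longrightarrow> smooth_on I g \<Longrightarrow> smooth_on I (\<lambda>x. f x - g x)"
  using smooth_on_add[OF _ smooth_on_minus] by simp

lemma smooth_on_divide:
  "smooth_on I f \<Longrightarrow> smooth_on I g \<Longrightarrow> (\<And>x. x \<in> I \<Longrightarrow> g x \<noteq> 0) \<Longrightarrow> smooth_on I (\<lambda>x. f x / g x)"
  unfolding divide_inverse
  by (rule smooth_on_mult) (simp_all add: smooth_on_iff times_differentiable_on_inverse)

lemma smooth_on_power: "smooth_on I f \<Longrightarrow> smooth_on I (\<lambda>x. f x ^ n)"
  by (induction n) (simp_all add: smooth_on_const smooth_on_mult)

lemma smooth_on_sqrt: "smooth_on I f \<Longrightarrow> (\<And>x. x \<in> I \<Longrightarrow> f x > 0) \<Longrightarrow> smooth_on I (\<lambda>x. sqrt (f x))"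
  by (simp add: smooth_on_iff times_differentiable_on_sqrt)

lemmas smooth_on_intros = smooth_on_const smooth_on_ident smooth_on_add smooth_on_mult smooth_on_minus
  smooth_on_diff smooth_on_divide smooth_on_power smooth_on_sqrt

lemma smooth_on_rho:
  assumes "\<And>m. m \<in> I \<Longrightarrow> disc m > 0" "-2 \<notin> I"
  shows "smooth_on I rho_minus" "smooth_on I rho_plus"
proof -
  have "(\<lambda>m. sqrt (disc m)) = (\<lambda>m. sqrt ((m\<^sup>2 - 1) * (m\<^sup>2 - 4 * m - 9)))"
    by (simp add: disc_def)
  moreover have "smooth_on I \<dots>"
    by (intro smooth_on_intros) (use assms(1) in \<open>simp add: disc_def\<close>)
  ultimately have "smooth_on I (\<lambda>m. sqrt (disc m))" by simp
  moreover have "m + 2 \<noteq> 0" if "m \<in> I" for m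
    using that assms(2) by (metis add_eq_0_iff2)
  then have "smooth_on I (\<lambda>m. (- m\<^sup>2 + m + 3 - s m) / (m + 2))"
    "smooth_on I (\<lambda>m. (- m\<^sup>2 + m + 3 + s m) / (m + 2))" if "smooth_on I s" for s
    by (intro smooth_on_intros that; simp)+
  ultimately show "smooth_on I rho_minus" "smooth_on I rho_plus"
    unfolding rho_minus_def[abs_def] rho_plus_def[abs_def] by blast+
qed

lemma kite_family_kite_of:
  assumes "\<And>m. m \<in> I \<Longrightarrow> \<rho> m \<in> admissible m" "smooth_on I \<rho>"
  shows "kite_family I (\<lambda>m. fst (kite_of m (\<rho> m))) (\<lambda>m. snd (kite_of m (\<rho> m)))"
proof -
  have nz: "(2 * m + 1) * (m + 2) \<noteq> 0" "sigma_sq m (\<rho> m) > 0" "sigma_sq m (\<rho> m) > 4 * \<rho> m" if "m \<in> I" for m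
    using admissible_cases[OF assms(1)[OF that]] assms(1)[OF that] by (auto simp: admissible_def)
  have \<sigma>: "smooth_on I (\<lambda>m. sigma_sq m (\<rho> m))"
    unfolding sigma_sq_def by (intro smooth_on_intros assms(2) nz)
  have "smooth_on I (\<lambda>m. fst (kite_of m (\<rho> m)))" "smooth_on I (\<lambda>m. snd (kite_of m (\<rho> m)))"
    unfolding kite_of_def fst_conv snd_conv
    by (intro smooth_on_intros \<sigma> assms(2); use nz in simp)+
  moreover have "kite_of m (\<rho> m) \<in> solutions m" if "m \<in> I" for m
    unfolding solutions_eq_UN using assms(1)[OF that] four_solutions_self by blast
  ultimately show ?thesis
    unfolding kite_family_def by simp
qed

end

section \<open>Bifurcation from the rhombus\<close>


text \<open>The larger root of the quadratic for the square of \<open>a\<close> in the rhombus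
  \<open>(a, - a)\<close>. For \<open>m < 0\<close> the smaller root is positive too but below 1, so
  there is a second rhombus to be kept away.\<close>

definition rhombus_sq :: "real \<Rightarrow> real" where
  "rhombus_sq m = (3 * (1 - m) + sqrt (9 * (1 - m)\<^sup>2 + 4 * m)) / 2"

lemma rhombus_disc_pos: "9 * (1 - m)\<^sup>2 + 4 * m > (0::real)"
proof -
  have "9 * (1 - m)\<^sup>2 + 4 * m = 9 * (m - 7/9)\<^sup>2 + 32/9"
    by (simp add: power2_eq_square algebra_simps)
  then show ?thesis by (simp add: add_nonneg_pos)
qed

lemma rhombus_sq_root: "(rhombus_sq m)\<^sup>2 + 3 * (m - 1) * rhombus_sq m - m = 0"
proof -
  have "2 * rhombus_sq m - 3 * (1 - m) = sqrt (9 * (1 - m)\<^sup>2 + 4 * m)"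
    by (simp add: rhombus_sq_def field_simps)
  then have "(2 * rhombus_sq m - 3 * (1 - m))\<^sup>2 = 9 * (1 - m)\<^sup>2 + 4 * m"
    using rhombus_disc_pos[of m] by simp
  then have "4 * ((rhombus_sq m)\<^sup>2 + 3 * (m - 1) * rhombus_sq m - m) = 0"
    by (simp add: power2_eq_square algebra_simps)
  then show ?thesis by simp
qed

lemma rhombus_sq_gt_1: "m < 0 \<Longrightarrow> rhombus_sq m > 1"
proof -
  assume "m < 0"
  then have "s > 0 \<Longrightarrow> (3 * (1 - m) + s) / 2 > 1" for s by simp
  from this[OF real_sqrt_gt_zero[OF rhombus_disc_pos]] show ?thesis
    by (simp only: rhombus_sq_def)
qed

text \<open>By Vieta two different roots \<open>u\<close>, \<open>t\<close> satisfy
  \<open>(u - 1) * (t - 1) = 2 * m - 2 < 0\<close>, so they cannot both exceed 1.\<close>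

lemma rhombus_sq_unique:
  assumes "m < 0" "u > 1" "u\<^sup>2 + 3 * (m - 1) * u - m = 0"
  shows "u = rhombus_sq m"
proof (rule ccontr)
  define t where "t = rhombus_sq m"
  assume "u \<noteq> rhombus_sq m"
  moreover have "(u - t) * (u + t + 3 * (m - 1)) = 0"
    using rhombus_sq_root[of m] assms(3) by (simp add: t_def power2_eq_square algebra_simps)
  ultimately have s: "u + t = 3 * (1 - m)"
    by (simp add: t_def)
  then have "t = 3 * (1 - m) - u" by simp
  then have "u * t = u * (3 * (1 - m) - u)" by simp
  also have "\<dots> = - m"
    using assms(3) by (simp add: power2_eq_square algebra_simps)
  finally have "(u - 1) * (t - 1) = 2 * m - 2"
    using s by (simp add: algebra_simps)
  moreover have "(u - 1) * (t - 1) > 0"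
    using assms(1,2) rhombus_sq_gt_1 by (simp add: t_def)
  ultimately show False
    using assms(1) by simp
qed

text \<open>Mass 0 is excluded because \<open>equilibria\<close> uses the undivided
  equations.\<close>

lemma equilibria_eq:
  assumes "m \<noteq> 0" "m \<noteq> -1"
  shows "equilibria m = solutions m \<union>
    {(a, - a) | a. a \<noteq> 0 \<and> (a\<^sup>2)\<^sup>2 + 3 * (m - 1) * a\<^sup>2 - m = 0 \<and> 1 + a\<^sup>2 + 4 * m \<noteq> 0}"
    (is "_ = _ \<union> ?R")
proof -
  have "(a, b) \<in> equilibria m \<longleftrightarrow> (a, b) \<in> solutions m \<union> ?R" for a b
  proof (cases "a + b = 0")
    case True
    then have b: "b = - a" by simp
    have "(a, b) \<notin> solutions m"
      using True by (simp add: solutions_iff)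
    then show ?thesis
      unfolding b equilibria_def relative_equilibrium_iff_divided[OF circulations_nonzero[OF assms(1)]]
      by (auto simp: relative_equilibrium_divided_rhombus)
  next
    case False
    then have "b \<noteq> - a" by auto
    then have "(a, b) \<notin> ?R" by blast
    then have "(a, b) \<in> solutions m \<union> ?R \<longleftrightarrow> (a, b) \<in> solutions m" by blast
    then show ?thesis
      using solutions_iff_divided[OF assms(2) False]
      by (simp add: equilibria_def relative_equilibrium_iff_divided[OF circulations_nonzero[OF assms(1)]])
  qed
  then show ?thesis by auto
qed

lemma rhombus_equilibrium:
  assumes "-2 < m" "m \<le> -1.6" and a: "a\<^sup>2 = rhombus_sq m"
  shows "(a, - a) \<in> equilibria m"
proof -
  \<comment> \<open>If \<open>\<omega>\<close> vanished, the quadratic would give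
    \<open>(m + 2)\<^sup>2 = 3\<close>, impossible in this range of \<open>m\<close>.\<close>
  have "1 + a\<^sup>2 + 4 * m \<noteq> 0"
  proof
    assume "1 + a\<^sup>2 + 4 * m = 0"
    then have "rhombus_sq m = - 1 - 4 * m" using a by simp
    then have "(m + 2)\<^sup>2 = 3"
      using rhombus_sq_root[of m, unfolded \<open>rhombus_sq m = - 1 - 4 * m\<close>] by (simp add: power2_eq_square algebra_simps)
    moreover have "(m + 2)\<^sup>2 \<le> 1"
      using assms by (intro power_le_one) auto
    ultimately show False by simp
  qed
  moreover have "a \<noteq> 0"
    using a rhombus_sq_gt_1[of m] assms by auto
  ultimately show ?thesis
    using equilibria_eq[of m] rhombus_sq_root[of m] assms unfolding a[symmetric] by auto
qed

text \<open>The constant term of the shifted polynomial vanishes at \<open>m_tilde\<close>, so its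
  roots are 0 and a positive number. Since \<open>x\<close> increases with \<open>\<rho>\<close>,
  the smaller root \<open>rho_minus\<close> corresponds to \<open>x = 0\<close>.\<close>

lemma sigma_sq_m_tilde: "sigma_sq m_tilde (rho_minus m_tilde) = 0"
proof -
  let ?m = m_tilde
  have m: "?m < -1.68035" "?m > -1.68045" using cubic_root by auto
  have D: "disc ?m > 0" using m disc_pos_left by simp
  define k n where "k = 5 * ?m\<^sup>2 + 10 * ?m + 3" and "n = ?m\<^sup>2 + 2 * ?m + 3"
  have "(?m + 1)\<^sup>2 \<ge> (68/100)\<^sup>2"
    using m(1) power_mono[of "68/100" "- (?m + 1)" 2] by (simp add: power2_eq_square algebra_simps)
  then have k: "k > 0"
    by (simp add: k_def power2_eq_square algebra_simps)
  define x where "x \<rho> = k * \<rho> + n" for \<rho>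
  define c where "c = (?m + 1) * (- 5 * ?m ^ 3 + ?m\<^sup>2 + 25 * ?m + 15)"
  have "c > 0"
    unfolding c_def using auxiliary_cubic_neg[of ?m] m by (intro mult_neg_neg) auto
  have roots: "x \<rho> = 0 \<or> x \<rho> = 2 * c / (?m + 2)" if "\<rho> = rho_minus ?m \<or> \<rho> = rho_plus ?m" for \<rho>
  proof -
    have "rho_poly ?m \<rho> = 0"
      using rho_poly_root_iff[of ?m \<rho>] that D m by auto
    then have "(?m + 2) * (x \<rho>)\<^sup>2 - 2 * c * x \<rho> = 0"
      using rho_poly_shift[of ?m \<rho>] cubic_root(2) by (simp add: c_def mult.assoc flip: k_def n_def x_def)
    then have "x \<rho> * ((?m + 2) * x \<rho> - 2 * c) = 0"
      by (simp add: power2_eq_square algebra_simps)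
    then have "x \<rho> = 0 \<or> (?m + 2) * x \<rho> = 2 * c"
      unfolding mult_eq_0_iff by simp
    then show ?thesis
      using m by (auto simp: eq_divide_eq mult.commute)
  qed
  have "x (rho_minus ?m) < x (rho_plus ?m)"
    using rho_minus_less_rho_plus[of ?m] D m k by (simp add: x_def)
  moreover have "2 * c / (?m + 2) > 0"
    using \<open>c > 0\<close> m by simp
  ultimately have "x (rho_minus ?m) = 0"
    using roots[of "rho_minus ?m"] roots[of "rho_plus ?m"] by auto
  then show ?thesis
    using sigma_sq_pos_iff(2)[of ?m "rho_minus ?m"] m by (simp add: x_def k_def n_def)
qed

text \<open>With \<open>\<sigma> = 0\<close> and \<open>u = - \<rho>\<close>, the two equilibrium
  relations combine to \<open>1 + u\<close> times the rhombus quadratic; \<open>u > 1\<close>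
  selects its larger root.\<close>

lemma rho_minus_m_tilde: "rho_minus m_tilde = - rhombus_sq m_tilde"
proof -
  let ?m = m_tilde
  define u where "u = - rho_minus ?m"
  have m: "?m < -1.68035" "?m > -1.68045" using cubic_root by auto
  have root: "rho_poly ?m (rho_minus ?m) = 0"
    using rho_poly_root_iff[of ?m] disc_pos_left[of ?m] m by simp
  then have u: "u > 1"
    using rho_less_minus_one[of ?m "rho_minus ?m"] m by (simp add: u_def)
  have "3 - (6 + 8 * ?m) * u - u\<^sup>2 = 0" "?m * (1 - u)\<^sup>2 + 4 * (2 + ?m) * u\<^sup>2 = 0"
    using sigma_sq_relations[OF root] m sigma_sq_m_tilde by (simp_all add: u_def)
  moreover have "(1 + u) * (u\<^sup>2 + 3 * (?m - 1) * u - ?m) =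
      - u * (3 - (6 + 8 * ?m) * u - u\<^sup>2) - (?m * (1 - u)\<^sup>2 + 4 * (2 + ?m) * u\<^sup>2)"
    by (simp add: power2_eq_square power3_eq_cube algebra_simps)
  ultimately have "u\<^sup>2 + 3 * (?m - 1) * u - ?m = 0"
    using u by simp
  then show ?thesis
    using rhombus_sq_unique[of ?m u] u m by (simp add: u_def)
qed

lemma kite_of_m_tilde:
  "kite_of m_tilde (rho_minus m_tilde) = (sqrt (rhombus_sq m_tilde), - sqrt (rhombus_sq m_tilde))"
  unfolding kite_of_def sigma_sq_m_tilde by (simp add: rho_minus_m_tilde real_sqrt_mult)

text \<open>The kite family is only defined left of \<open>m_tilde\<close>, but its formula is
  continuous across, as \<open>sqrt\<close> is continuous on all reals. This yields the limit at the
  bifurcation.\<close>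

lemma continuous_on_kite_of: "continuous_on {-2<..<-1/2} (\<lambda>m. kite_of m (rho_minus m))"
  unfolding kite_of_def sigma_sq_def rho_minus_def disc_def
  by (intro continuous_intros) auto

text \<open>\<open>U\<close> separates the bifurcating rhombus and its two kites from the rhombus with \<open>\<bar>y3\<bar> < 1\<close> and from
  the configurations with vortices 3 and 4 interchanged, which belong to \<open>- e\<close>.\<close>

lemma equilibria_near_rhombus:
  assumes m: "-2 < m" "m \<le> -1.6" and e: "e \<in> {1, -1 :: real}"
  defines "r \<equiv> sqrt (rhombus_sq m)" and "U \<equiv> {(x, y). e * x > 0 \<and> e * y < 0 \<and> x * y < -1}"
  shows "m < m_tilde \<Longrightarrow> kite_of m (rho_minus m) = (a, b) \<Longrightarrow>
      equilibria m \<inter> U = {(e * r, - (e * r)), (e * a, e * b), (- (e * b), - (e * a))} \<and>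
      distinct [(e * r, - (e * r)), (e * a, e * b), (- (e * b), - (e * a))]"
    and "m \<ge> m_tilde \<Longrightarrow> equilibria m \<inter> U = {(e * r, - (e * r))}"
proof -
  have r: "r > 1" "r\<^sup>2 = rhombus_sq m"
    using rhombus_sq_gt_1[of m] m by (auto simp: r_def)
  have ee: "e * e = 1" using e by auto
  have mem: "(e * r, - (e * r)) \<in> equilibria m \<inter> U"
  proof -
    have "(e * r)\<^sup>2 = rhombus_sq m"
      using r(2) ee by (simp add: power2_eq_square mult_ac)
    then have "(e * r, - (e * r)) \<in> equilibria m"
      using rhombus_equilibrium m by blast
    moreover have "1 < r * r"
      using r(1) less_1_mult by blast
    ultimately show ?thesis
      using r(1) e by (auto simp: U_def)
  qed
  \<comment> \<open>An equilibrium that is no kite is a rhombus \<open>(x, - x)\<close>. Membership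
    in \<open>U\<close> gives \<open>x\<^sup>2 > 1\<close>, hence the larger root, and
    \<open>e\<close> fixes the sign of \<open>x\<close>.\<close>
  have other: "p = (e * r, - (e * r))" if p_in: "p \<in> equilibria m \<inter> U" "p \<notin> solutions m" for p
  proof -
    have "m \<noteq> 0" "m \<noteq> -1" using m by auto
    then have "equilibria m = solutions m \<union>
        {(a, - a) | a. a \<noteq> 0 \<and> (a\<^sup>2)\<^sup>2 + 3 * (m - 1) * a\<^sup>2 - m = 0 \<and> 1 + a\<^sup>2 + 4 * m \<noteq> 0}"
      by (rule equilibria_eq)
    then obtain x where p: "p = (x, - x)" and x: "(x\<^sup>2)\<^sup>2 + 3 * (m - 1) * x\<^sup>2 - m = 0"
      using p_in by blast
    have "x\<^sup>2 > 1" "e * x > 0"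
      using p_in(1) p by (auto simp: U_def power2_eq_square)
    then have "x\<^sup>2 = r\<^sup>2"
      using rhombus_sq_unique[of m "x\<^sup>2"] x m r(2) by simp
    then have "x = r \<or> x = - r"
      by (simp add: power2_eq_iff)
    then show ?thesis
      using \<open>e * x > 0\<close> r(1) e unfolding p by auto
  qed
  {
    assume "m < m_tilde" and ab: "kite_of m (rho_minus m) = (a, b)"
    note adm = admissible_convex[OF m(1) \<open>m < m_tilde\<close>]
    have \<rho>: "rho_minus m \<in> admissible m" using adm(1) by simp
    note k = kite_of_properties[OF \<rho> ab]
    have sol: "solutions m = {(a, b), (- a, - b), (b, a), (- b, - a)}"
      unfolding solutions_eq_UN adm(1) by (simp add: ab)
    have ab1: "a * b < -1" using k(4) adm(2) by simp
    have "a > 0" "b < 0"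
    proof -
      have "a * b < 0" using ab1 by simp
      then show "a > 0" "b < 0" using k(2) by (auto simp: mult_less_0_iff)
    qed
    then have "solutions m \<inter> U = {(e * a, e * b), (- (e * b), - (e * a))}"
      unfolding sol U_def using e ab1 by (auto simp: mult.commute)
    moreover have "solutions m \<subseteq> equilibria m"
      using equilibria_eq[of m] m by auto
    ultimately have "equilibria m \<inter> U = {(e * r, - (e * r)), (e * a, e * b), (- (e * b), - (e * a))}"
      using other mem by blast
    moreover have "distinct [(e * r, - (e * r)), (e * a, e * b), (- (e * b), - (e * a))]"
      using k(1) e by auto
    ultimately show "equilibria m \<inter> U = {(e * r, - (e * r)), (e * a, e * b), (- (e * b), - (e * a))} \<and>
      distinct [(e * r, - (e * r)), (e * a, e * b), (- (e * b), - (e * a))]" by blast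
  next
    assume "m \<ge> m_tilde"
    then have "solutions m = {}"
      unfolding solutions_eq_UN using m admissible_empty[of m] by auto
    then show "equilibria m \<inter> U = {(e * r, - (e * r))}"
      using other mem by blast
  }
qed

text \<open>The rhombus occurs as two ordered pairs, chosen by \<open>e\<close>, and each has its
  own pitchfork with two of the four kites. The outer branches are exchanged by
  \<open>(x, y)\<close> to \<open>(- y, - x)\<close>, which fixes the rhombus.\<close>

lemma pitchfork_kites:
  assumes e: "e \<in> {1, -1 :: real}"
  shows "pitchfork_at equilibria m_tilde
    (\<lambda>m. (e * sqrt (rhombus_sq m), - (e * sqrt (rhombus_sq m))))
    (\<lambda>m. (e * fst (kite_of m (rho_minus m)), e * snd (kite_of m (rho_minus m))))
    (\<lambda>m. (- (e * snd (kite_of m (rho_minus m))), - (e * fst (kite_of m (rho_minus m)))))"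
    (is "pitchfork_at _ _ ?c ?p ?q")
proof -
  let ?U = "{(x, y). e * x > 0 \<and> e * y < 0 \<and> x * y < -1}"
  have mt: "-1.68045 < m_tilde" "m_tilde < -1.68035" using cubic_root by auto
  have "?U = {z. 0 < e * fst z} \<inter> {z. e * snd z < 0} \<inter> {z. fst z * snd z < -1}"
    by auto
  moreover have "open \<dots>"
    by (intro open_Int open_Collect_less continuous_intros)
  ultimately have "open ?U" by simp
  have "equilibria m_tilde \<inter> ?U = {?c m_tilde}"
    using equilibria_near_rhombus(2)[OF _ _ e, of m_tilde] mt by simp
  then have "?c m_tilde \<in> ?U" by blast
  \<comment> \<open>The radius 5/100 keeps \<open>m\<close> between -2 and -1.6, where the
    description of the equilibria in \<open>?U\<close> holds.\<close>
  have sub: "{m_tilde - 5/100<..<m_tilde} \<subseteq> {-2<..<-1/2}"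
    using mt by auto
  have cont: "continuous_on {-2<..<-1/2} (\<lambda>m. fst (kite_of m (rho_minus m)))"
    "continuous_on {-2<..<-1/2} (\<lambda>m. snd (kite_of m (rho_minus m)))"
    by (intro continuous_on_fst continuous_on_snd continuous_on_kite_of)+
  have pq: "continuous_on {-2<..<-1/2} ?p" "continuous_on {-2<..<-1/2} ?q"
    by (intro continuous_intros cont)+
  have "m_tilde \<in> {-2<..<-1/2}" using mt by auto
  then have "isCont ?p m_tilde" "isCont ?q m_tilde"
    using pq by (simp_all add: continuous_on_eq_continuous_at)
  then have "(?p \<longlongrightarrow> ?p m_tilde) (at_left m_tilde)" "(?q \<longlongrightarrow> ?q m_tilde) (at_left m_tilde)"
    unfolding isCont_def by (auto intro: tendsto_within_subset)
  then have lim: "(?p \<longlongrightarrow> ?c m_tilde) (at_left m_tilde)" "(?q \<longlongrightarrow> ?c m_tilde) (at_left m_tilde)"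
    by (simp_all add: kite_of_m_tilde)
  have c: "continuous_on {m_tilde - 5/100<..<m_tilde + 5/100} ?c"
    unfolding rhombus_sq_def by (intro continuous_intros) auto
  have left: "equilibria m \<inter> ?U = {?c m, ?p m, ?q m} \<and> distinct [?c m, ?p m, ?q m]"
    if "m \<in> {m_tilde - 5/100<..<m_tilde}" for m
    using equilibria_near_rhombus(1)[of m e "fst (kite_of m (rho_minus m))" "snd (kite_of m (rho_minus m))"] that mt e
    by auto
  have right: "equilibria m \<inter> ?U = {?c m}" if "m \<in> {m_tilde..<m_tilde + 5/100}" for m
    using equilibria_near_rhombus(2)[of m e] that mt e by auto
  show ?thesis
    unfolding pitchfork_at_def
    by (rule exI[of _ "5/100"], rule conjI, simp, rule exI[of _ ?U])
      (intro conjI ballI \<open>open ?U\<close> \<open>?c m_tilde \<in> ?U\<close> c lim pq[THEN continuous_on_subset, OF sub] left right; simp)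
qed

lemma rhombus_family_sqrt:
  "rhombus_family {m_tilde - 5/100<..<m_tilde + 5/100} (\<lambda>m. sqrt (rhombus_sq m))"
proof -
  let ?I = "{m_tilde - 5/100<..<m_tilde + 5/100}"
  have mt: "-1.68045 < m_tilde" "m_tilde < -1.68035" using cubic_root by auto
  have pos: "rhombus_sq m > 1" if "m \<in> ?I" for m
    using rhombus_sq_gt_1[of m] that mt by auto
  have "smooth_on ?I (\<lambda>m. (3 * (1 - m) + sqrt (9 * (1 - m)\<^sup>2 + 4 * m)) / 2)"
    by (intro smooth_on_intros rhombus_disc_pos) auto
  then have "smooth_on ?I (\<lambda>m. rhombus_sq m)"
    by (simp add: rhombus_sq_def)
  then have "smooth_on ?I (\<lambda>m. sqrt (rhombus_sq m))"
    by (rule smooth_on_sqrt[rotated]) (use pos in force)+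
  moreover have "sqrt (rhombus_sq m) > 0 \<and>
      relative_equilibrium (circulations m) (cfg (sqrt (rhombus_sq m), - sqrt (rhombus_sq m)))" if "m \<in> ?I" for m
    using pos[OF that] rhombus_equilibrium[of m "sqrt (rhombus_sq m)"] that mt
    by (auto simp: equilibria_def)
  ultimately show ?thesis
    unfolding rhombus_family_def by blast
qed

section \<open>Hessian and nullity\<close>


lemma has_derivative_vec:
  fixes f :: "'a::real_normed_vector \<Rightarrow> ('b::euclidean_space)^'n"
  assumes "\<And>i. ((\<lambda>x. f x $ i) has_derivative (\<lambda>h. f' h $ i)) (at x)"
  shows "(f has_derivative f') (at x)"
proof -
  \<comment> \<open>\<open>E i\<close> embeds a vector as the component \<open>i\<close>; the
    components recombine to the whole as a sum of these embeddings.\<close>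
  define E :: "'n \<Rightarrow> 'b \<Rightarrow> 'b^'n" where "E i u = (\<chi> k. if k = i then u else 0)" for i u
  have E: "bounded_linear (E i)" for i
    unfolding linear_conv_bounded_linear[symmetric]
    by (rule linearI) (auto simp: E_def vec_eq_iff)
  have sum: "(\<Sum>i\<in>UNIV. E i (w $ i)) = w" for w :: "'b^'n"
    by (simp add: vec_eq_iff E_def)
  have "((\<lambda>x. \<Sum>i\<in>UNIV. E i (f x $ i)) has_derivative (\<lambda>h. \<Sum>i\<in>UNIV. E i (f' h $ i))) (at x)"
    by (intro has_derivative_sum bounded_linear.has_derivative[OF E] assms)
  then show ?thesis
    by (simp add: sum)
qed

text \<open>Summation over all \<open>j\<close> is harmless: the term \<open>j = i\<close> contains
  \<open>w $ i - w $ i\<close>. The same holds for \<open>ham_hess\<close>.\<close>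

definition ham_grad :: "circ \<Rightarrow> config \<Rightarrow> config" where
  "ham_grad \<Gamma> w = (\<chi> i. - (\<Sum>j\<in>UNIV. (\<Gamma> $ i * \<Gamma> $ j / (dist (w $ i) (w $ j))\<^sup>2) *\<^sub>R (w $ i - w $ j)))"

definition ham_hess :: "circ \<Rightarrow> config \<Rightarrow> config \<Rightarrow> config" where
  "ham_hess \<Gamma> w v = (\<chi> i. - (\<Sum>j\<in>UNIV. (\<Gamma> $ i * \<Gamma> $ j) *\<^sub>R
     ((1 / (dist (w $ i) (w $ j))\<^sup>2) *\<^sub>R (v $ i - v $ j) -
      (2 * ((w $ i - w $ j) \<bullet> (v $ i - v $ j)) / (dist (w $ i) (w $ j)) ^ 4) *\<^sub>R (w $ i - w $ j))))"

text \<open>Each pair in the Hamiltonian contributes opposite vectors to two components of the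
  gradient; this passes from pairs \<open>i < j\<close> to a sum per component, whatever the order
  on labels.\<close>

lemma sum_less_pairs_antisym:
  fixes u :: "'n::{finite, linorder} \<Rightarrow> 'n \<Rightarrow> 'b::real_inner"
  assumes "\<And>i j. u j i = - u i j"
  shows "(\<Sum>(i, j)\<in>{(i, j). i < j}. u i j \<bullet> (h i - h j)) = (\<Sum>i\<in>UNIV. \<Sum>j\<in>UNIV. u i j \<bullet> h i)"
proof -
  have u0: "u i i = 0" for i
  proof -
    have "u i i + u i i = 0"
      by (subst (2) assms) simp
    then have "2 *\<^sub>R u i i = 0"
      by (simp only: scaleR_2)
    then show ?thesis by simp
  qed
  have swap: "u i j \<bullet> (h i - h j) = u i j \<bullet> h i + u j i \<bullet> h j" for i j
    by (simp add: assms[of i j] inner_diff_right)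
  have "(\<Sum>(i, j)\<in>{(i, j). i < j}. u i j \<bullet> (h i - h j)) =
      (\<Sum>(i, j)\<in>{(i, j). i < j}. u i j \<bullet> h i) + (\<Sum>(i, j)\<in>{(i, j). i < j}. u j i \<bullet> h j)"
    by (subst sum.distrib[symmetric], rule sum.cong) (auto simp: swap)
  also have "(\<Sum>(i, j)\<in>{(i, j). i < j}. u j i \<bullet> h j) = (\<Sum>(i, j)\<in>{(i, j). j < i}. u i j \<bullet> h i)"
    by (rule sum.reindex_bij_witness[where i="\<lambda>(i, j). (j, i)" and j="\<lambda>(i, j). (j, i)"]) auto
  also have "(\<Sum>(i, j)\<in>{(i, j). i < j}. u i j \<bullet> h i) + (\<Sum>(i, j)\<in>{(i, j). j < i}. u i j \<bullet> h i)
      = (\<Sum>(i, j)\<in>{(i, j). i < j} \<union> {(i, j). j < i}. u i j \<bullet> h i)"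
    by (rule sum.union_disjoint[symmetric]) (auto intro: finite_subset[OF subset_UNIV])
  also have "\<dots> = (\<Sum>(i, j)\<in>UNIV \<times> UNIV. u i j \<bullet> h i)"
    by (rule sum.mono_neutral_left) (auto simp: not_less u0 intro: order.antisym)
  also have "\<dots> = (\<Sum>i\<in>UNIV. \<Sum>j\<in>UNIV. u i j \<bullet> h i)"
    by (simp add: sum.cartesian_product)
  finally show ?thesis .
qed

lemma has_derivative_component:
  "((\<lambda>w::'b::euclidean_space^'n. w $ i) has_derivative (\<lambda>h. h $ i)) F"
  by (rule bounded_linear_imp_has_derivative[OF bounded_linear_vec_nth])

lemma has_derivative_ln_norm:
  fixes f :: "'a::real_normed_vector \<Rightarrow> 'b::real_inner"
  assumes "(f has_derivative f') (at w)" "f w \<noteq> 0"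
  shows "((\<lambda>w. ln (norm (f w))) has_derivative (\<lambda>h. (f w \<bullet> f' h) / (norm (f w))\<^sup>2)) (at w)"
proof -
  have "((\<lambda>w. norm (f w)) has_derivative (\<lambda>h. f' h \<bullet> sgn (f w))) (at w)"
    by (rule has_derivative_compose[OF assms(1) has_derivative_norm[OF assms(2)]])
  moreover have "(ln has_derivative (*) (1 / norm (f w))) (at (norm (f w)))"
    using DERIV_ln_divide[of "norm (f w)"] assms(2) by (simp add: has_field_derivative_def)
  ultimately have "((\<lambda>w. ln (norm (f w))) has_derivative (\<lambda>h. (1 / norm (f w)) * (f' h \<bullet> sgn (f w)))) (at w)"
    by (rule has_derivative_compose)
  then show ?thesis
    by (rule has_derivative_eq_rhs) (simp add: sgn_div_norm power2_eq_square inner_commute divide_simps)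
qed

lemma hamiltonian_has_derivative:
  assumes "collision_free w"
  shows "(hamiltonian \<Gamma> has_derivative (\<lambda>h. ham_grad \<Gamma> w \<bullet> h)) (at w)"
proof -
  define u where "u i j = (\<Gamma> $ i * \<Gamma> $ j / (dist (w $ i) (w $ j))\<^sup>2) *\<^sub>R (w $ i - w $ j)" for i j
  have "((\<lambda>w. \<Sum>(i, j)\<in>{(i, j). i < j}. \<Gamma> $ i * \<Gamma> $ j * ln (norm (w $ i - w $ j)))
      has_derivative (\<lambda>h. \<Sum>(i, j)\<in>{(i, j). i < j}. \<Gamma> $ i * \<Gamma> $ j *
        (((w $ i - w $ j) \<bullet> (h $ i - h $ j)) / (norm (w $ i - w $ j))\<^sup>2))) (at w)"
    using assms unfolding case_prod_unfold
    by (intro has_derivative_sum has_derivative_mult_right has_derivative_ln_norm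
          has_derivative_diff has_derivative_component) (auto simp: collision_free_def)
  also have "(\<lambda>h::config. \<Sum>(i, j)\<in>{(i, j). i < j}. \<Gamma> $ i * \<Gamma> $ j *
        (((w $ i - w $ j) \<bullet> (h $ i - h $ j)) / (norm (w $ i - w $ j))\<^sup>2))
      = (\<lambda>h. \<Sum>(i, j)\<in>{(i, j). i < j}. u i j \<bullet> (h $ i - h $ j))"
    by (simp add: u_def dist_norm)
  also have "\<dots> = (\<lambda>h. \<Sum>i\<in>UNIV. \<Sum>j\<in>UNIV. u i j \<bullet> h $ i)"
    by (rule ext, rule sum_less_pairs_antisym)
       (simp add: u_def dist_commute mult.commute scaleR_right_diff_distrib)
  finally have "((\<lambda>w. \<Sum>(i, j)\<in>{(i, j). i < j}. \<Gamma> $ i * \<Gamma> $ j * ln (norm (w $ i - w $ j)))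
      has_derivative (\<lambda>h. \<Sum>i\<in>UNIV. \<Sum>j\<in>UNIV. u i j \<bullet> h $ i)) (at w)" .
  from has_derivative_minus[OF this] show ?thesis
    unfolding hamiltonian_def[abs_def] dist_norm
    by (rule has_derivative_eq_rhs)
       (subst inner_vec_def, simp add: ham_grad_def u_def dist_norm inner_sum_left sum_negf)
qed

lemma gradient_hamiltonian: "collision_free w \<Longrightarrow> gradient (hamiltonian \<Gamma>) w = ham_grad \<Gamma> w"
  unfolding gradient_def frechet_derivative_at[OF hamiltonian_has_derivative, symmetric]
  by (rule euclidean_representation)

text \<open>The formula for the gradient is known only at collision-free points; openness permits
  differentiating it there.\<close>

lemma open_collision_free: "open {w. collision_free w}"
proof -
  have "open {w::config. w $ i \<noteq> w $ j}" for i j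
    by (intro open_Collect_neq continuous_intros)
  then have "open (\<Inter>i. \<Inter>j\<in>-{i}. {w::config. w $ i \<noteq> w $ j})"
    by (intro open_INT) auto
  also have "(\<Inter>i. \<Inter>j\<in>-{i}. {w::config. w $ i \<noteq> w $ j}) = {w. collision_free w}"
    by (auto simp: collision_free_def)
  finally show ?thesis .
qed

lemma has_derivative_div_norm_square:
  fixes f :: "'a::real_normed_vector \<Rightarrow> 'b::real_inner"
  assumes f: "(f has_derivative f') (at w)" and "f w \<noteq> 0"
  shows "((\<lambda>w. (c / (norm (f w))\<^sup>2) *\<^sub>R f w) has_derivative
    (\<lambda>h. c *\<^sub>R ((1 / (norm (f w))\<^sup>2) *\<^sub>R f' h - (2 * (f w \<bullet> f' h) / (norm (f w)) ^ 4) *\<^sub>R f w))) (at w)"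
proof -
  let ?q = "f w \<bullet> f w"
  have nz: "?q \<noteq> 0" using assms by simp
  have "((\<lambda>w. f w \<bullet> f w) has_derivative (\<lambda>h. f w \<bullet> f' h + f' h \<bullet> f w)) (at w)"
    by (intro has_derivative_inner f)
  from has_derivative_divide'[OF has_derivative_const[of c] this nz]
  have "((\<lambda>w. c / (f w \<bullet> f w)) has_derivative
      (\<lambda>h. - (c * (f w \<bullet> f' h + f' h \<bullet> f w)) / (?q * ?q))) (at w)"
    by simp
  from has_derivative_scaleR[OF this f] show ?thesis
    unfolding power2_norm_eq_inner
  proof (rule has_derivative_eq_rhs, intro ext)
    fix h
    have n4: "norm (f w) ^ 4 = ?q * ?q"
      by (simp add: power4_eq_xxxx flip: power2_norm_eq_inner)
    show "(c / ?q) *\<^sub>R f' h + (- (c * (f w \<bullet> f' h + f' h \<bullet> f w)) / (?q * ?q)) *\<^sub>R f w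
        = c *\<^sub>R ((1 / ?q) *\<^sub>R f' h - (2 * (f w \<bullet> f' h) / norm (f w) ^ 4) *\<^sub>R f w)"
      unfolding n4 inner_commute[of "f' h"] by (simp add: scaleR_diff_right)
  qed
qed

lemma hessian_hamiltonian:
  assumes "collision_free z"
  shows "hessian (hamiltonian \<Gamma>) z = ham_hess \<Gamma> z"
proof -
  have "(ham_grad \<Gamma> has_derivative ham_hess \<Gamma> z) (at z)"
  proof (rule has_derivative_vec)
    fix i
    have "((\<lambda>w::config. (\<Gamma> $ i * \<Gamma> $ j / (norm (w $ i - w $ j))\<^sup>2) *\<^sub>R (w $ i - w $ j)) has_derivative
      (\<lambda>v. (\<Gamma> $ i * \<Gamma> $ j) *\<^sub>R
     ((1 / (norm (z $ i - z $ j))\<^sup>2) *\<^sub>R (v $ i - v $ j) -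
      (2 * ((z $ i - z $ j) \<bullet> (v $ i - v $ j)) / (norm (z $ i - z $ j)) ^ 4) *\<^sub>R (z $ i - z $ j)))) (at z)" for j
    proof (cases "i = j")
      case False
      then show ?thesis using assms
        by (intro has_derivative_div_norm_square has_derivative_diff has_derivative_component)
           (auto simp: collision_free_def)
    qed simp
    then show "((\<lambda>w. ham_grad \<Gamma> w $ i) has_derivative (\<lambda>v. ham_hess \<Gamma> z v $ i)) (at z)"
      unfolding ham_grad_def ham_hess_def dist_norm vec_lambda_beta
      by (intro has_derivative_minus has_derivative_sum)
  qed
  then have "(gradient (hamiltonian \<Gamma>) has_derivative ham_hess \<Gamma> z) (at z)"
    by (rule has_derivative_transform_within_open[OF _ open_collision_free])
       (use assms in \<open>auto simp: gradient_hamiltonian\<close>)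
  then show ?thesis
    unfolding hessian_def using frechet_derivative_at by metis
qed


section \<open>The kernel at the equilateral triangle with its center\<close>

lemma circulations_one: "circulations 1 $ i = 1"
  using exhaust_4[of i] by (auto simp: circulations_def vector_def)

text \<open>Leaving open which of the vortices 3 and 4 is the center \<open>q\<close>, and the sign
  of \<open>h\<close>, lets one computation cover all four solutions.\<close>

lemma nullity_equilateral:
  fixes z :: config and h :: real
  assumes pq: "UNIV = {1, 2, p, q}" "distinct [1, 2, p, q]" and h: "h\<^sup>2 = 1 / 3"
    and z: "z $ 1 = vector [1, 0]" "z $ 2 = vector [-1, 0]"
      "z $ p = vector [0, 3 * h]" "z $ q = vector [0, h]"
  shows "nullity (circulations 1) (3 / 2) z = 3"
proof -
  have sum_pq: "(\<Sum>j\<in>UNIV. f j) = f 1 + f 2 + f p + f q" for f :: "4 \<Rightarrow> real^2"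
    unfolding pq(1) using pq(2) by (simp add: ac_simps)
  have all_pq: "(\<forall>j. P j) \<longleftrightarrow> P 1 \<and> P 2 \<and> P p \<and> P q" for P
    using pq(1) by (metis (full_types) UNIV_I empty_iff insert_iff)
  have [simp]: "h * h = 1 / 3" "h * (3 * h) = 1" "h \<noteq> 0"
    using h by (auto simp: power2_eq_square)
  have [simp]: "h * (h * x) = x / 3" for x
    by (simp flip: mult.assoc)
  have dist2: "(dist a b)\<^sup>2 = (a $ 1 - b $ 1)\<^sup>2 + (a $ 2 - b $ 2)\<^sup>2" for a b :: "real^2"
    by (simp add: dist_vec_def L2_set_def sum_2 dist_real_def)
  have r: "(dist (z $ 1) (z $ 2))\<^sup>2 = 4" "(dist (z $ 1) (z $ p))\<^sup>2 = 4" "(dist (z $ 2) (z $ p))\<^sup>2 = 4"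
     "(dist (z $ 1) (z $ q))\<^sup>2 = 4 / 3" "(dist (z $ 2) (z $ q))\<^sup>2 = 4 / 3" "(dist (z $ p) (z $ q))\<^sup>2 = 4 / 3"
    using h by (simp_all add: dist2 z power_mult_distrib)
  have r4: "(dist a b) ^ 4 = ((dist a b)\<^sup>2)\<^sup>2" for a b :: "real^2"
    by simp
  note R = r r[unfolded dist_commute[of "z $ 1" "z $ 2"] dist_commute[of "z $ 1" "z $ p"] dist_commute[of "z $ 2" "z $ p"]
     dist_commute[of "z $ 1" "z $ q"] dist_commute[of "z $ 2" "z $ q"] dist_commute[of "z $ p" "z $ q"]]
  have cf: "collision_free z"
  proof -
    have "z $ 1 \<noteq> z $ 2" "z $ 1 \<noteq> z $ p" "z $ 2 \<noteq> z $ p" "z $ 1 \<noteq> z $ q" "z $ 2 \<noteq> z $ q" "z $ p \<noteq> z $ q"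
      using r by auto
    then show ?thesis
      unfolding collision_free_def all_pq by simp
  qed
  \<comment> \<open>The general solution of the kernel equations; the free parameters are the first
    component at \<open>p\<close> and both components at \<open>q\<close>.\<close>
  define K :: "real^3 \<Rightarrow> config" where "K x = (\<chi> i.
      if i = 1 then vector [- x$1 / 2 - x$2 / 2 - h * x$3, - 3 * h / 2 * x$1 - 5 * h / 2 * x$2 - 2 / 3 * x$3]
      else if i = 2 then vector [- x$1 / 2 - x$2 / 2 + h * x$3, 3 * h / 2 * x$1 + 5 * h / 2 * x$2 - 2 / 3 * x$3]
      else if i = p then vector [x$1, x$3 / 3]
      else vector [x$2, x$3])" for x
  have Ks: "K x $ 1 = vector [- x$1 / 2 - x$2 / 2 - h * x$3, - 3 * h / 2 * x$1 - 5 * h / 2 * x$2 - 2 / 3 * x$3]"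
    "K x $ 2 = vector [- x$1 / 2 - x$2 / 2 + h * x$3, 3 * h / 2 * x$1 + 5 * h / 2 * x$2 - 2 / 3 * x$3]"
    "K x $ p = vector [x$1, x$3 / 3]" "K x $ q = vector [x$2, x$3]" for x
    using pq(2) by (auto simp: K_def)
  have ker: "hessian (hamiltonian (circulations 1)) z v + (3 / 2) *\<^sub>R mass_operator (circulations 1) v = 0
      \<longleftrightarrow> v \<in> range K" (is "?ker v \<longleftrightarrow> _") for v
  proof -
    \<comment> \<open>scaling the second components by \<open>3 * h = 1 / h\<close> makes the linear system rational\<close>
    define A2 A4 V6 V8 where "A2 = 3 * h * v$1$2" and "A4 = 3 * h * v$2$2"
      and "V6 = 3 * h * v$p$2" and "V8 = 3 * h * v$q$2"
    note d = A2_def A4_def V6_def V8_def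
    have v: "v$1$2 = h * A2" "v$2$2 = h * A4" "v$p$2 = h * V6" "v$q$2 = h * V8"
      by (simp_all add: d)
    let ?L = "\<lambda>i. (ham_hess (circulations 1) z v + (3 / 2) *\<^sub>R mass_operator (circulations 1) v) $ i"
    have hess: "?L i = - (\<Sum>j\<in>UNIV. (1 / (dist (z $ i) (z $ j))\<^sup>2) *\<^sub>R (v $ i - v $ j) -
        (2 * ((z $ i - z $ j) \<bullet> (v $ i - v $ j)) / ((dist (z $ i) (z $ j))\<^sup>2)\<^sup>2) *\<^sub>R (z $ i - z $ j))
        + (3 / 2) *\<^sub>R v $ i" for i
      by (simp add: ham_hess_def mass_operator_def circulations_one)
    note simps = inner_vec_def sum_2 z v power2_eq_square[of "_::real"] algebra_simps
      add_divide_distrib diff_divide_distrib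
    have L: "?L 1 $ 1 = 2 * v$1$1 - A2 / 2 - v$2$1 / 4 + v$p$1 / 8 + V6 / 8 - 3/8 * v$q$1 + 3/8 * V8"
      "?L 1 $ 2 = h * (-3/2 * v$1$1 + A2 + A4/4 + 3/8 * v$p$1 - V6/8 + 9/8 * v$q$1 + 3/8 * V8)"
      "?L 2 $ 1 = 2 * v$2$1 + A4/2 - v$1$1/4 + v$p$1/8 - V6/8 - 3/8 * v$q$1 - 3/8 * V8"
      "?L 2 $ 2 = h * (3/2 * v$2$1 + A4 + A2/4 - 3/8 * v$p$1 - V6/8 - 9/8 * v$q$1 + 3/8 * V8)"
      "?L p $ 1 = v$1$1/8 + A2/8 + v$2$1/8 - A4/8 + v$p$1/2 + 3/4 * v$q$1"
      "?L p $ 2 = h * (3/8 * v$1$1 - A2/8 - 3/8 * v$2$1 - A4/8 + 5/2 * V6 - 3/4 * V8)"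
      "?L q $ 1 = - 3/8 * v$1$1 + 3/8 * A2 - 3/8 * v$2$1 - 3/8 * A4 + 3/4 * v$p$1 + 3/2 * v$q$1"
      "?L q $ 2 = h * (9/8 * v$1$1 + 3/8 * A2 - 9/8 * v$2$1 + 3/8 * A4 - 3/4 * V6 + 3/2 * V8)"
      unfolding hess sum_pq R by (simp_all add: simps)
    have "?ker v \<longleftrightarrow> (\<forall>i. ?L i $ 1 = 0 \<and> ?L i $ 2 = 0)"
      by (simp add: hessian_hamiltonian[OF cf] vec_eq_iff forall_2)
    \<comment> \<open>Gaussian elimination: the eight equations have rank 5.\<close>
    also have "\<dots> \<longleftrightarrow> v$1$1 = - v$p$1 / 2 - v$q$1 / 2 - V8 / 3 \<and> A2 = - 3/2 * v$p$1 - 5/2 * v$q$1 - 2/3 * V8 \<and>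
        v$2$1 = - v$p$1 / 2 - v$q$1 / 2 + V8 / 3 \<and> A4 = 3/2 * v$p$1 + 5/2 * v$q$1 - 2/3 * V8 \<and> V6 = V8 / 3"
      unfolding all_pq L mult_eq_0_iff using \<open>h \<noteq> 0\<close> by (simp; linarith)
    also have "\<dots> \<longleftrightarrow> v = K (vector [v$p$1, v$q$1, v$q$2])"
    proof -
      have "- 3 * h / 2 * v$p$1 - 5 * h / 2 * v$q$1 - 2/3 * (h * V8) = h * (- 3/2 * v$p$1 - 5/2 * v$q$1 - 2/3 * V8)"
        "3 * h / 2 * v$p$1 + 5 * h / 2 * v$q$1 - 2/3 * (h * V8) = h * (3/2 * v$p$1 + 5/2 * v$q$1 - 2/3 * V8)"
        "h * V8 / 3 = h * (V8 / 3)"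
        by (simp_all add: algebra_simps)
      then have "A2 = - 3/2 * v$p$1 - 5/2 * v$q$1 - 2/3 * V8 \<longleftrightarrow>
          v$1$2 = - 3 * h / 2 * v$p$1 - 5 * h / 2 * v$q$1 - 2/3 * v$q$2"
        "A4 = 3/2 * v$p$1 + 5/2 * v$q$1 - 2/3 * V8 \<longleftrightarrow>
          v$2$2 = 3 * h / 2 * v$p$1 + 5 * h / 2 * v$q$1 - 2/3 * v$q$2"
        "V6 = V8 / 3 \<longleftrightarrow> v$p$2 = v$q$2 / 3"
        unfolding v by (simp_all only: mult_cancel_left \<open>h \<noteq> 0\<close> simp_thms)
      moreover have "V8 / 3 = h * v$q$2"
        by (simp add: d)
      ultimately show ?thesis
        unfolding vec_eq_iff[of v] all_pq Ks forall_2 vec_eq_iff[of "v $ _"] by simp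
    qed
    also have "\<dots> \<longleftrightarrow> v \<in> range K"
    proof
      assume "v \<in> range K"
      then obtain x where "v = K x" by auto
      then have "vector [v$p$1, v$q$1, v$q$2] = x"
        by (simp add: Ks vec_eq_iff forall_3)
      then show "v = K (vector [v$p$1, v$q$1, v$q$2])"
        using \<open>v = K x\<close> by simp
    qed auto
    finally show ?thesis .
  qed
  have "linear K"
    by (rule linearI) (simp_all add: vec_eq_iff all_pq forall_2 Ks algebra_simps add_divide_distrib diff_divide_distrib)
  moreover have "inj K"
  proof (rule injI)
    fix x y assume "K x = K y"
    then have "K x $ p = K y $ p" "K x $ q = K y $ q" by simp_all
    then have "x $ 1 = y $ 1" "x $ 2 = y $ 2" "x $ 3 = y $ 3"
      unfolding Ks by (simp_all add: vec_eq_iff forall_2)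
    then show "x = y"
      by (simp add: vec_eq_iff forall_3)
  qed
  ultimately have "dim (range K) = 3"
    using dim_image_eq[of K UNIV] by simp
  then show ?thesis
    unfolding nullity_def ker by simp
qed

section \<open>The families of kites\<close>


lemma solutions_one:
  assumes "p \<in> solutions 1"
  obtains h where "h\<^sup>2 = 1 / 3" "p = (3 * h, h) \<or> p = (h, 3 * h)"
proof -
  define s where "s = sqrt (1 / 3 :: real)"
  have s: "s\<^sup>2 = 1 / 3" "s \<ge> 0" by (simp_all add: s_def)
  \<comment> \<open>Here \<open>\<rho> = 1\<close> and \<open>sigma_sq = 16/3\<close>, so sum and
    difference of the coordinates are \<open>4 * s\<close> and \<open>2 * s\<close>.\<close>
  have sum: "sigma_sq 1 1 = (4 * s)\<^sup>2" and diff: "sigma_sq 1 1 - 4 * 1 = (2 * s)\<^sup>2"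
    using s by (simp_all add: sigma_sq_def power_mult_distrib)
  have "sqrt ((4 * s)\<^sup>2) = 4 * s" "sqrt ((2 * s)\<^sup>2) = 2 * s"
    using s(2) by (simp_all only: real_sqrt_abs)
  then have "kite_of 1 1 = ((4 * s + 2 * s) / 2, (4 * s - 2 * s) / 2)"
    unfolding kite_of_def diff unfolding sum by simp
  then have "kite_of 1 1 = (3 * s, s)" by simp
  then have "p \<in> four_solutions (3 * s, s)"
    using assms by (simp add: solutions_eq_UN admissible_one)
  then have "p = (3 * s, s) \<or> p = (s, 3 * s) \<or> p = (3 * (- s), - s) \<or> p = (- s, 3 * (- s))"
    by auto
  then show ?thesis
    using that[of s] that[of "- s"] s(1) by fastforce
qed

lemma equilateral_with_center_cfg:
  assumes h: "h\<^sup>2 = 1 / 3"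
  shows "equilateral_with_center (cfg (3 * h, h))" "equilateral_with_center (cfg (h, 3 * h))"
proof -
  define T :: "real^2" where "T = vector [0, 3 * h]"
  have "(dist (vector [1, 0] :: real^2) (vector [-1, 0]))\<^sup>2 = 4" "(dist (vector [-1, 0]) T)\<^sup>2 = 4"
    "(dist T (vector [1, 0]))\<^sup>2 = 4"
    using h by (simp_all add: dist_square_2 power_mult_distrib T_def)
  then have "dist (vector [1, 0] :: real^2) (vector [-1, 0]) = dist (vector [-1, 0]) T"
    "dist (vector [-1, 0]) T = dist T (vector [1, 0])"
    by (metis power2_eq_imp_eq zero_le_dist)+
  then have tri: "equilateral_triangle (vector [1, 0]) (vector [-1, 0]) T"
    by (simp add: equilateral_triangle_def vec_eq_iff forall_2)
  have center: "vector [0, h] = (1 / 3) *\<^sub>R (vector [1, 0] + vector [-1, 0] + T)"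
    by (simp add: T_def vec_eq_iff forall_2)
  show "equilateral_with_center (cfg (3 * h, h))"
    unfolding equilateral_with_center_def
    by (rule exI[of _ 4], rule exI[of _ 1], rule exI[of _ 2], rule exI[of _ 3])
      (use tri center UNIV_4 in \<open>auto simp: T_def\<close>)
  show "equilateral_with_center (cfg (h, 3 * h))"
    unfolding equilateral_with_center_def
    by (rule exI[of _ 3], rule exI[of _ 1], rule exI[of _ 2], rule exI[of _ 4])
      (use tri center UNIV_4 in \<open>auto simp: T_def\<close>)
qed

lemma nullity_cfg_one:
  assumes h: "h\<^sup>2 = 1 / 3"
  shows "nullity (circulations 1) (3 / 2) (cfg (3 * h, h)) = 3"
    "nullity (circulations 1) (3 / 2) (cfg (h, 3 * h)) = 3"
proof -
  have "UNIV = {1, 2, 4, 3 :: 4}"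
    unfolding UNIV_4 by blast
  then show "nullity (circulations 1) (3 / 2) (cfg (h, 3 * h)) = 3"
    by (rule nullity_equilateral[OF _ _ h]) simp_all
  show "nullity (circulations 1) (3 / 2) (cfg (3 * h, h)) = 3"
    by (rule nullity_equilateral[OF UNIV_4 _ h]) simp_all
qed

text \<open>The equation for vortex 1 gives \<open>\<omega> = 1/2 + 1/4 + 3/4\<close>.\<close>

lemma omega_one:
  assumes h: "h\<^sup>2 = 1 / 3" and "p = (3 * h, h) \<or> p = (h, 3 * h)"
    and "relative_equilibrium_with (circulations 1) \<omega> (cfg p)"
  shows "\<omega> = 3 / 2"
proof -
  have "divided_equations (circulations 1) \<omega> (cfg p)"
    using assms(3) relative_equilibrium_with_iff[OF circulations_nonzero, of 1] by simp
  then show ?thesis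
    using assms(2) by (auto simp: divided_equations_cfg power_mult_distrib h)
qed

lemma kites_mass_one:
  "card (solutions 1) = 4 \<and>
     (\<forall>p\<in>solutions 1. concave_config (cfg p) \<and> equilateral_with_center (cfg p) \<and>
        (\<forall>\<omega>. relative_equilibrium_with (circulations 1) \<omega> (cfg p) \<longrightarrow>
           degenerate (circulations 1) \<omega> (cfg p) \<and> nullity (circulations 1) \<omega> (cfg p) = 3))"
proof (intro conjI ballI allI impI)
  show "card (solutions 1) = 4"
    by (simp add: card_solutions admissible_one)
next
  fix p assume "p \<in> solutions 1"
  then obtain h where h: "h\<^sup>2 = 1 / 3" "p = (3 * h, h) \<or> p = (h, 3 * h)"
    by (rule solutions_one)
  have "h * h = 1 / 3"
    using h(1) by (simp add: power2_eq_square)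
  then have "concave_config (cfg (3 * h, h))" "concave_config (cfg (h, 3 * h))"
    by (auto intro!: concave_cfg simp: power2_eq_square)
  then show "concave_config (cfg p)"
    using h(2) by auto
  show "equilateral_with_center (cfg p)"
    using h equilateral_with_center_cfg by auto
  fix \<omega> assume "relative_equilibrium_with (circulations 1) \<omega> (cfg p)"
  then have \<omega>: "\<omega> = 3 / 2" by (rule omega_one[OF h])
  show "nullity (circulations 1) \<omega> (cfg p) = 3"
    unfolding \<omega> using h(2) nullity_cfg_one[OF h(1)] by auto
  then show "degenerate (circulations 1) \<omega> (cfg p)"
    by (simp add: degenerate_def)
qed

lemma solutions_concave:
  assumes "p \<in> solutions m" "\<And>\<rho>. \<rho> \<in> admissible m \<Longrightarrow> \<rho> > 0"
  shows "concave_config (cfg p)"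
proof -
  obtain a b where p: "p = (a, b)" by fastforce
  obtain \<rho> where \<rho>: "\<rho> \<in> admissible m" "(a, b) \<in> four_solutions (kite_of m \<rho>)"
    using assms(1) unfolding solutions_eq_UN p by blast
  have "a * b > 0"
    using mult_kite_solutions[OF \<rho>] assms(2)[OF \<rho>(1)] by simp
  moreover have "a \<noteq> b" "a + b \<noteq> 0"
    using assms(1) by (simp_all add: p solutions_iff)
  then have "a\<^sup>2 \<noteq> b\<^sup>2"
    by (simp add: power2_eq_iff add_eq_0_iff2)
  ultimately show ?thesis
    unfolding p by (rule concave_cfg)
qed

lemma solutions_convex:
  assumes "p \<in> solutions m" "\<And>\<rho>. \<rho> \<in> admissible m \<Longrightarrow> \<rho> < 0"
  shows "convex_config (cfg p)"
proof -
  obtain a b where p: "p = (a, b)" by fastforce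
  obtain \<rho> where \<rho>: "\<rho> \<in> admissible m" "(a, b) \<in> four_solutions (kite_of m \<rho>)"
    using assms(1) unfolding solutions_eq_UN p by blast
  have "a * b < 0"
    using mult_kite_solutions[OF \<rho>] assms(2)[OF \<rho>(1)] by simp
  then show ?thesis
    unfolding p by (rule convex_cfg)
qed

lemma same_shape_kite_of:
  assumes "\<rho> \<in> admissible m" "\<rho>' \<in> admissible m" "m \<noteq> 1"
    "same_shape (circulations m) (cfg (kite_of m \<rho>)) (cfg (kite_of m \<rho>'))"
  shows "\<rho> = \<rho>'"
proof -
  obtain a b c d where ab: "kite_of m \<rho> = (a, b)" and cd: "kite_of m \<rho>' = (c, d)" by fastforce
  show ?thesis
    using same_shape_imp_mult_eq[of m a b c d] assms ab cd
      kite_of_properties(4)[OF assms(1) ab] kite_of_properties(4)[OF assms(2) cd] by simp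
qed

text \<open>At \<open>m = 0\<close> one has \<open>\<rho> = 0\<close> and
  \<open>sigma_sq = 3\<close>: vortex 4 sits midway between 1 and 2, and vortex 3 is the apex at
  height \<open>sqrt 3\<close>.\<close>

lemma collinear_kite_of_zero: "collinear_with_equilateral_exterior (cfg (kite_of 0 (rho_minus 0)))"
proof -
  define T :: "real^2" where "T = vector [0, sqrt 3]"
  have k: "kite_of 0 (rho_minus 0) = (sqrt 3, 0)"
    by (simp add: kite_of_def rho_minus_zero sigma_sq_def)
  have "(dist (vector [1, 0] :: real^2) (vector [-1, 0]))\<^sup>2 = 4" "(dist (vector [-1, 0]) T)\<^sup>2 = 4"
    "(dist T (vector [1, 0]))\<^sup>2 = 4"
    by (simp_all add: dist_square_2 T_def)
  then have "dist (vector [1, 0] :: real^2) (vector [-1, 0]) = dist (vector [-1, 0]) T"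
    "dist (vector [-1, 0]) T = dist T (vector [1, 0])"
    by (metis power2_eq_imp_eq zero_le_dist)+
  then have tri: "equilateral_triangle (vector [1, 0]) (vector [-1, 0]) T"
    by (simp add: equilateral_triangle_def vec_eq_iff forall_2)
  have seg: "(vector [0, 0] :: real^2) \<in> open_segment (vector [1, 0]) (vector [-1, 0])"
    unfolding in_segment by (auto simp: vec_eq_iff forall_2 intro!: exI[of _ "1/2"])
  show ?thesis
    unfolding collinear_with_equilateral_exterior_def k
    by (rule exI[of _ 4], rule exI[of _ 1], rule exI[of _ 2], rule exI[of _ 3])
      (use tri seg UNIV_4 in \<open>auto simp: T_def\<close>)
qed

text \<open>The family that persists is the branch \<open>rho_minus\<close>: one formula, smooth on
  the whole interval as \<open>disc\<close> is positive there, crosses 0 at \<open>m = 0\<close> and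
  so turns concave kites into convex ones.\<close>

lemma kites_mass_above_minus_half:
  "(\<forall>m. 0 < m \<and> m < 1 \<longrightarrow>
        card (solutions m) = 8 \<and> num_shapes m = 2 \<and> (\<forall>p\<in>solutions m. concave_config (cfg p))) \<and>
     (\<exists>a1 b1 a2 b2.
        kite_family {-1/2<..<1} a1 b1 \<and> kite_family {0<..<1} a2 b2 \<and>
        (\<forall>m\<in>{0<..<1}.
           solutions m = four_solutions (a1 m, b1 m) \<union> four_solutions (a2 m, b2 m) \<and>
           \<not> same_shape (circulations m) (cfg (a1 m, b1 m)) (cfg (a2 m, b2 m))) \<and>
        (\<forall>m\<in>{-1/2<..0}. solutions m = four_solutions (a1 m, b1 m)) \<and>
        (\<forall>m\<in>{-1/2<..<0}. convex_config (cfg (a1 m, b1 m))) \<and>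
        collinear_with_equilateral_exterior (cfg (a1 0, b1 0)))"
proof (intro conjI allI impI)
  fix m :: real assume m: "0 < m \<and> m < 1"
  note adm = admissible_unit[of m]
  have "card (admissible m) = 2"
    using adm m by simp
  then show "card (solutions m) = 8" "num_shapes m = 2"
    using m by (simp_all add: card_solutions num_shapes_eq)
  show "\<forall>p\<in>solutions m. concave_config (cfg p)"
    using solutions_concave[of _ m] adm m by fastforce
next
  let ?a1 = "\<lambda>m. fst (kite_of m (rho_minus m))" and ?b1 = "\<lambda>m. snd (kite_of m (rho_minus m))"
  let ?a2 = "\<lambda>m. fst (kite_of m (rho_plus m))" and ?b2 = "\<lambda>m. snd (kite_of m (rho_plus m))"
  have adm: "rho_minus m \<in> admissible m" if "m \<in> {-1/2<..<1}" for m
    using that admissible_unit(1)[of m] admissible_negative_mass[of m] admissible_zero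
    by (cases m "0 :: real" rule: linorder_cases) auto
  have sol: "solutions m = four_solutions (?a1 m, ?b1 m)" if "m \<in> {-1/2<..0}" for m
    using that admissible_negative_mass[of m] admissible_zero
    by (cases "m = 0") (auto simp: solutions_eq_UN)
  show "\<exists>a1 b1 a2 b2.
        kite_family {-1/2<..<1} a1 b1 \<and> kite_family {0<..<1} a2 b2 \<and>
        (\<forall>m\<in>{0<..<1}.
           solutions m = four_solutions (a1 m, b1 m) \<union> four_solutions (a2 m, b2 m) \<and>
           \<not> same_shape (circulations m) (cfg (a1 m, b1 m)) (cfg (a2 m, b2 m))) \<and>
        (\<forall>m\<in>{-1/2<..0}. solutions m = four_solutions (a1 m, b1 m)) \<and>
        (\<forall>m\<in>{-1/2<..<0}. convex_config (cfg (a1 m, b1 m))) \<and>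
        collinear_with_equilateral_exterior (cfg (a1 0, b1 0))"
  proof (rule exI[of _ ?a1], rule exI[of _ ?b1], rule exI[of _ ?a2], rule exI[of _ ?b2], intro conjI ballI)
    show "kite_family {-1/2<..<1} ?a1 ?b1"
      by (intro kite_family_kite_of adm smooth_on_rho disc_pos_middle) auto
    show "kite_family {0<..<1} ?a2 ?b2"
      by (intro kite_family_kite_of smooth_on_rho disc_pos_middle) (auto simp: admissible_unit(1))
    show "solutions m = four_solutions (?a1 m, ?b1 m) \<union> four_solutions (?a2 m, ?b2 m)"
      if "m \<in> {0<..<1}" for m
      using that admissible_unit(1)[of m] by (simp add: solutions_eq_UN)
    show "\<not> same_shape (circulations m) (cfg (?a1 m, ?b1 m)) (cfg (?a2 m, ?b2 m))"
      if "m \<in> {0<..<1}" for m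
      using that admissible_unit[of m] same_shape_kite_of[of "rho_minus m" m "rho_plus m"] by auto
    show "solutions m = four_solutions (?a1 m, ?b1 m)" if "m \<in> {-1/2<..0}" for m
      using sol that by blast
    show "convex_config (cfg (?a1 m, ?b1 m))" if m: "m \<in> {-1/2<..<0}" for m
    proof (rule solutions_convex)
      show "(?a1 m, ?b1 m) \<in> solutions m"
        using sol[of m] m four_solutions_self[of "(?a1 m, ?b1 m)"] by auto
      show "\<rho> < 0" if "\<rho> \<in> admissible m" for \<rho>
        using that m admissible_negative_mass[of m] rho_minus_neg(1)[of m] by simp
    qed
    show "collinear_with_equilateral_exterior (cfg (?a1 0, ?b1 0))"
      using collinear_kite_of_zero by simp
  qed
qed

lemma kites_mass_between_minus_two_and_m_tilde:
  "(\<exists>!x::real. 5 * x ^ 3 + 7 * x\<^sup>2 + 3 * x + 9 = 0) \<and> \<bar>m_tilde + 1.6804\<bar> < 0.00005 \<and>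
     (\<forall>m. -2 < m \<and> m < m_tilde \<longrightarrow>
        card (solutions m) = 4 \<and> num_shapes m = 1 \<and> (\<forall>p\<in>solutions m. convex_config (cfg p))) \<and>
     (\<exists>a b r \<delta>.
        kite_family {-2<..<m_tilde} a b \<and>
        (\<forall>m\<in>{-2<..<m_tilde}. solutions m = four_solutions (a m, b m)) \<and>
        \<delta> > 0 \<and> rhombus_family {m_tilde - \<delta><..<m_tilde + \<delta>} r \<and>
        pitchfork_at equilibria m_tilde
          (\<lambda>m. (r m, - r m)) (\<lambda>m. (a m, b m)) (\<lambda>m. (- b m, - a m)) \<and>
        pitchfork_at equilibria m_tilde
          (\<lambda>m. (- r m, r m)) (\<lambda>m. (- a m, - b m)) (\<lambda>m. (b m, a m)))"
proof (intro conjI allI impI)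
  show "\<exists>!x::real. 5 * x ^ 3 + 7 * x\<^sup>2 + 3 * x + 9 = 0"
    using cubic_root(1) unfolding cubic_def .
  show "\<bar>m_tilde + 1.6804\<bar> < 0.00005"
    using cubic_root(3,4) unfolding abs_less_iff by auto
next
  fix m assume m: "-2 < m \<and> m < m_tilde"
  note adm = admissible_convex[of m]
  have "m \<noteq> 1" using m cubic_root(4) by auto
  then show "card (solutions m) = 4" "num_shapes m = 1"
    using adm m by (simp_all add: card_solutions num_shapes_eq)
  show "\<forall>p\<in>solutions m. convex_config (cfg p)"
    using solutions_convex[of _ m] adm m by fastforce
next
  let ?a = "\<lambda>m. fst (kite_of m (rho_minus m))" and ?b = "\<lambda>m. snd (kite_of m (rho_minus m))"
  let ?r = "\<lambda>m. sqrt (rhombus_sq m)"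
  show "\<exists>a b r \<delta>.
        kite_family {-2<..<m_tilde} a b \<and>
        (\<forall>m\<in>{-2<..<m_tilde}. solutions m = four_solutions (a m, b m)) \<and>
        \<delta> > 0 \<and> rhombus_family {m_tilde - \<delta><..<m_tilde + \<delta>} r \<and>
        pitchfork_at equilibria m_tilde
          (\<lambda>m. (r m, - r m)) (\<lambda>m. (a m, b m)) (\<lambda>m. (- b m, - a m)) \<and>
        pitchfork_at equilibria m_tilde
          (\<lambda>m. (- r m, r m)) (\<lambda>m. (- a m, - b m)) (\<lambda>m. (b m, a m))"
  proof (rule exI[of _ ?a], rule exI[of _ ?b], rule exI[of _ ?r], rule exI[of _ "5/100"], intro conjI ballI)
    show "kite_family {-2<..<m_tilde} ?a ?b"
      by (intro kite_family_kite_of smooth_on_rho disc_pos_left)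
        (use admissible_convex(1) cubic_root(4) in auto)
    show "solutions m = four_solutions (?a m, ?b m)" if "m \<in> {-2<..<m_tilde}" for m
      using that admissible_convex(1)[of m] by (simp add: solutions_eq_UN)
    show "pitchfork_at equilibria m_tilde (\<lambda>m. (?r m, - ?r m)) (\<lambda>m. (?a m, ?b m)) (\<lambda>m. (- ?b m, - ?a m))"
      using pitchfork_kites[of 1] by simp
    show "pitchfork_at equilibria m_tilde (\<lambda>m. (- ?r m, ?r m)) (\<lambda>m. (- ?a m, - ?b m)) (\<lambda>m. (?b m, ?a m))"
      using pitchfork_kites[of "-1"] by simp
  qed (simp_all add: rhombus_family_sqrt[simplified])
qed

lemma kites_mass_below_minus_two:
  "(\<forall>m. m < -2 \<longrightarrow>
        card (solutions m) = 4 \<and> num_shapes m = 1 \<and> (\<forall>p\<in>solutions m. concave_config (cfg p))) \<and>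
     (\<exists>a b. kite_family {..< -2} a b \<and>
        (\<forall>m\<in>{..< -2}. solutions m = four_solutions (a m, b m)))"
proof (intro conjI allI impI)
  fix m :: real assume m: "m < -2"
  note adm = admissible_left[OF m]
  show "card (solutions m) = 4" "num_shapes m = 1"
    using adm m by (simp_all add: card_solutions num_shapes_eq)
  show "\<forall>p\<in>solutions m. concave_config (cfg p)"
    using solutions_concave[of _ m] adm m by fastforce
next
  let ?a = "\<lambda>m. fst (kite_of m (rho_minus m))" and ?b = "\<lambda>m. snd (kite_of m (rho_minus m))"
  have "kite_family {..< -2} ?a ?b"
    by (intro kite_family_kite_of smooth_on_rho disc_pos_left) (auto simp: admissible_left(1))
  moreover have "solutions m = four_solutions (?a m, ?b m)" if "m \<in> {..< -2}" for m
    using that admissible_left(1)[of m] by (simp add: solutions_eq_UN)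
  ultimately show "\<exists>a b. kite_family {..< -2} a b \<and>
        (\<forall>m\<in>{..< -2}. solutions m = four_solutions (a m, b m))"
    by blast
qed

theorem theorem4p3:
  shows "
    \<comment> \<open>the formulas give kite relative equilibria, and all of those of the given form\<close>
    ((\<forall>m. \<forall>p\<in>solutions m.
        kite_config (cfg p) \<and> relative_equilibrium (circulations m) (cfg p)) \<and>
     (\<forall>m. total_circulation (circulations m) \<noteq> 0 \<longrightarrow> solutions m = kite_equilibria m)) \<and>
    \<comment> \<open>(i)\<close>
    (card (solutions 1) = 4 \<and>
     (\<forall>p\<in>solutions 1. concave_config (cfg p) \<and> equilateral_with_center (cfg p) \<and>
        (\<forall>\<omega>. relative_equilibrium_with (circulations 1) \<omega> (cfg p) \<longrightarrow>
           degenerate (circulations 1) \<omega> (cfg p) \<and> nullity (circulations 1) \<omega> (cfg p) = 3))) \<and>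
    \<comment> \<open>(ii)\<close>
    ((\<forall>m. 0 < m \<and> m < 1 \<longrightarrow>
        card (solutions m) = 8 \<and> num_shapes m = 2 \<and> (\<forall>p\<in>solutions m. concave_config (cfg p))) \<and>
     (\<exists>a1 b1 a2 b2.
        kite_family {-1/2<..<1} a1 b1 \<and> kite_family {0<..<1} a2 b2 \<and>
        (\<forall>m\<in>{0<..<1}.
           solutions m = four_solutions (a1 m, b1 m) \<union> four_solutions (a2 m, b2 m) \<and>
           \<not> same_shape (circulations m) (cfg (a1 m, b1 m)) (cfg (a2 m, b2 m))) \<and>
        (\<forall>m\<in>{-1/2<..0}. solutions m = four_solutions (a1 m, b1 m)) \<and>
        (\<forall>m\<in>{-1/2<..<0}. convex_config (cfg (a1 m, b1 m))) \<and>
        collinear_with_equilateral_exterior (cfg (a1 0, b1 0)))) \<and>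
    \<comment> \<open>(iii)\<close>
    ((\<exists>!x::real. 5 * x ^ 3 + 7 * x\<^sup>2 + 3 * x + 9 = 0) \<and> \<bar>m_tilde + 1.6804\<bar> < 0.00005 \<and>
     (\<forall>m. -2 < m \<and> m < m_tilde \<longrightarrow>
        card (solutions m) = 4 \<and> num_shapes m = 1 \<and> (\<forall>p\<in>solutions m. convex_config (cfg p))) \<and>
     (\<exists>a b r \<delta>.
        kite_family {-2<..<m_tilde} a b \<and>
        (\<forall>m\<in>{-2<..<m_tilde}. solutions m = four_solutions (a m, b m)) \<and>
        \<delta> > 0 \<and> rhombus_family {m_tilde - \<delta><..<m_tilde + \<delta>} r \<and>
        pitchfork_at equilibria m_tilde
          (\<lambda>m. (r m, - r m)) (\<lambda>m. (a m, b m)) (\<lambda>m. (- b m, - a m)) \<and>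
        pitchfork_at equilibria m_tilde
          (\<lambda>m. (- r m, r m)) (\<lambda>m. (- a m, - b m)) (\<lambda>m. (b m, a m)))) \<and>
    \<comment> \<open>(iv)\<close>
    ((\<forall>m. m < -2 \<longrightarrow>
        card (solutions m) = 4 \<and> num_shapes m = 1 \<and> (\<forall>p\<in>solutions m. concave_config (cfg p))) \<and>
     (\<exists>a b. kite_family {..< -2} a b \<and>
        (\<forall>m\<in>{..< -2}. solutions m = four_solutions (a m, b m)))) \<and>
    \<comment> \<open>(v)\<close>
    (\<forall>m. m \<notin> {1} \<union> {-1/2<..<1} \<union> {-2<..<m_tilde} \<union> {..< -2} \<longrightarrow> solutions m = {})"
proof (intro conjI[OF _ conjI[OF kites_mass_one conjI[OF kites_mass_above_minus_half conjI[OF kites_mass_between_minus_two_and_m_tilde conjI[OF kites_mass_below_minus_two]]]]])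
  show "(\<forall>m. \<forall>p\<in>solutions m.
        kite_config (cfg p) \<and> relative_equilibrium (circulations m) (cfg p)) \<and>
     (\<forall>m. total_circulation (circulations m) \<noteq> 0 \<longrightarrow> solutions m = kite_equilibria m)"
  proof (intro conjI allI ballI impI)
    fix m p assume p: "p \<in> solutions m"
    then show "kite_config (cfg p)"
      using kite_config_cfg by (cases p) (simp add: solutions_iff)
    show "relative_equilibrium (circulations m) (cfg p)"
      using solutions_imp_divided[OF p] by (rule divided_imp_relative_equilibrium)
  next
    fix m assume "total_circulation (circulations m) \<noteq> 0"
    then show "solutions m = kite_equilibria m"
      by (intro solutions_eq_kite_equilibria) (auto simp: total_circulation_circulations)
  qed
  show "\<forall>m. m \<notin> {1} \<union> {-1/2<..<1} \<union> {-2<..<m_tilde} \<union> {..< -2} \<longrightarrow> solutions m = {}"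
    unfolding solutions_eq_UN using admissible_empty by blast
qed

end
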